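(* Let $A=(a_{ij})_{0\le i,j\le n}\in M_{n+1}(k)$ be a nonzero matrix, and let $X_A\subset \mathbb{P}^n$ be the hypersurface of degree $q+1$ defined by $\sum_{i,j} a_{ij}x_ix_j^q=0$ in the projective space $\mathbb{P}^n$ with homogeneous coordinates $(x_0,x_1,\dots,x_n)$. Suppose that the rank of $A$ is $n$. Then $X_A$ is projectively isomorphic to one of the hypersurfaces $X_s$ ($0\le s\le n$) associated with the matrices $$W_s=\left(\begin{array}{c|c} I_s & 0\\ \hline 0 & E_{n-s+1}\end{array}\right).$$ Moreover, if $s\ne s'$ (with $0\le s,s'\le n$), then $X_s$ and $X_{s'}$ are not projectively isomorphic.
   Context: $k$ is an algebraically closed field of characteristic $p>0$, $q$ is a power of $p$ (so $q=p^e$ with $e\ge 1$), and $n$ is a positive integer. $M_{n+1}(k)$ is the set of $(n+1)\times(n+1)$ matrices over $k$. For a matrix $T$, ${}^tT$ is its transpose and $T^{(q)}$ is the matrix obtained by raising each entry to the $q$-th power. $I_s$ is the $s\times s$ identity matrix. $E_r$ is the $r\times r$ matrix with entries $1$ on the subdiagonal (positions $(i+1,i)$) and $0$ elsewhere; in particular $E_1=(0)$ and $E_0$ is the $0\times 0$ matrix. $X_s$ denotes $X_{W_s}$, the hypersurface defined by the form $\sum a_{ij}x_ix_j^q$ with $(a_{ij})=W_s$. Two hypersurfaces $X_A,X_{A'}$ are projectively isomorphic (as hypersurfaces with their defining equations, i.e. as subschemes of $\mathbb{P}^n$, via an element of $PGL_{n+1}(k)$) if and only if there exists $T\in GL_{n+1}(k)$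 with $A'={}^tTAT^{(q)}$. *)

theory Defs
  imports
    "HOL-Library.Poly_Mapping"
    "HOL-Computational_Algebra.Computational_Algebra"
    "Jordan_Normal_Form.Matrix"
    "Jordan_Normal_Form.DL_Rank"
begin

section \<open>Homogeneous coordinate ring of projective n-space\<close>

text \<open>
  Polynomials in countably many variables are finitely supported functions from exponent vectors
  to coefficients; the multiplication of this type is the convolution product.  The ring
  k[x_0, ..., x_n] is the subring of those polynomials in which only variables of
  index at most n occur.
\<close>

type_synonym 'k mpoly = "(nat \<Rightarrow>\<^sub>0 nat) \<Rightarrow>\<^sub>0 'k"

definition Var :: "nat \<Rightarrow> 'k::comm_semiring_1 mpoly" where
  "Var i = Poly_Mapping.single (Poly_Mapping.single i 1) 1"

definition Const :: "'k::comm_semiring_1 \<Rightarrow> 'k mpoly" where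
  "Const c = Poly_Mapping.single 0 c"

definition coord_ring :: "nat \<Rightarrow> 'k::comm_semiring_1 mpoly set" where
  "coord_ring n = {F. \<forall>m \<in> Poly_Mapping.keys F. Poly_Mapping.keys m \<subseteq> {..n}}"

definition subst_mpoly :: "(nat \<Rightarrow> 'k mpoly) \<Rightarrow> 'k::comm_semiring_1 mpoly \<Rightarrow> 'k mpoly" where
  "subst_mpoly \<sigma> F =
     (\<Sum>m \<in> Poly_Mapping.keys F. Const (Poly_Mapping.lookup F m) *
        (\<Prod>i \<in> Poly_Mapping.keys m. \<sigma> i ^ Poly_Mapping.lookup m i))"


section \<open>Hypersurfaces and projective isomorphism\<close>

text \<open>
  The hypersurface defined by a nonzero form F of k[x_0, ..., x_n] is a closed subscheme of
  projective n-space, and as such it is represented by its homogeneous ideal.  For n at least 1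
  this is the principal ideal generated by F, since that ideal is saturated.  In particular the
  multiplicities of the components are part of the data, unlike for the zero set of F.
\<close>

definition hypersurface :: "nat \<Rightarrow> 'k::comm_semiring_1 mpoly \<Rightarrow> 'k mpoly set" where
  "hypersurface n F = {G * F | G. G \<in> coord_ring n}"

definition frob_form :: "nat \<Rightarrow> nat \<Rightarrow> 'k::comm_semiring_1 mat \<Rightarrow> 'k mpoly" where
  "frob_form q n A = (\<Sum>i\<le>n. \<Sum>j\<le>n. Const (A $$ (i, j)) * Var i * Var j ^ q)"

definition X_hyp :: "nat \<Rightarrow> nat \<Rightarrow> 'k::comm_semiring_1 mat \<Rightarrow> 'k mpoly set" where
  "X_hyp q n A = hypersurface n (frob_form q n A)"

text \<open>
  Substituting the i-th coordinate of T x for x_i pulls functions back along the linear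
  automorphism T, so it sends the ideal of a subscheme Y to the ideal of the inverse image of Y
  under T.
\<close>

definition lin_pullback :: "nat \<Rightarrow> 'k::comm_semiring_1 mat \<Rightarrow> 'k mpoly \<Rightarrow> 'k mpoly" where
  "lin_pullback n T = subst_mpoly (\<lambda>i. \<Sum>j\<le>n. Const (T $$ (i, j)) * Var j)"

text \<open>
  Elements of the projective linear group are given by invertible matrices, and proportional
  matrices act in the same way on homogeneous ideals.  It is immaterial whether images or inverse
  images are used, because all elements of a group are considered.
\<close>

definition proj_isomorphic ::
    "nat \<Rightarrow> 'k::comm_ring_1 mpoly set \<Rightarrow> 'k mpoly set \<Rightarrow> bool" where
  "proj_isomorphic n I J \<longleftrightarrow>
     (\<exists>T \<in> carrier_mat (n + 1) (n + 1). invertible_mat T \<and> lin_pullback n T ` I = J)"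


section \<open>The normal forms\<close>

definition E_mat :: "nat \<Rightarrow> 'k::{zero,one} mat" where
  "E_mat r = mat r r (\<lambda>(i, j). if i = j + 1 then 1 else 0)"

definition W_mat :: "nat \<Rightarrow> nat \<Rightarrow> 'k::{zero,one} mat" where
  "W_mat n s = four_block_mat (1\<^sub>m s) (0\<^sub>m s (n - s + 1))
                              (0\<^sub>m (n - s + 1) s) (E_mat (n - s + 1))"

end

theory Submission
  imports Defs "HOL-Library.Function_Algebras"
begin

text \<open>
  For a matrix A put \<open>\<phi> x y = (\<Sum>i j. a_ij x_i y_j^q)\<close>.  This form is additive in both arguments,
  linear in x and q-semilinear in y, and the substitution \<open>x \<mapsto> T x\<close> turns it into the form whose
  matrix is \<open>T\<^sup>t A T^(q)\<close>.  Comparing the homogeneous components of lowest degree shows that an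
  isomorphism between two of the hypersurfaces amounts to an equality of such matrices up to a
  constant factor (\<open>proj_isomorphic_X_hypI\<close>, \<open>proj_isomorphic_X_hypD\<close>).  The rest is a
  classification of the pairs (V, \<open>\<phi>\<close>) for V of finite dimension.

  Existence.  If the right radical of \<open>\<phi>\<close> is zero, then the functional \<open>x \<mapsto> (\<phi> x v)^q\<close> has the form
  \<open>\<phi> v'\<close> for each v.  The orbit of a vector under \<open>v \<mapsto> v'\<close> spans a space in which a fixed point
  can be computed by solving one polynomial equation (\<open>hermitian_vector_exists\<close>).  A fixed point v
  satisfies \<open>\<phi> v x = (\<phi> x v)^q\<close>, so its left and right orthogonal spaces coincide.  If
  \<open>\<phi> v v \<noteq> 0\<close>, it splits off; otherwise a hyperbolic plane splits off.  By induction \<open>\<phi>\<close> has an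
  orthonormal basis (\<open>orthonormal_basis_exists\<close>); this is the statement that
  \<open>A = T\<^sup>t T^(q)\<close> is solvable for invertible A, which is also a consequence of Lang's theorem.

  If the right radical is a line, spanned by v, then either \<open>\<phi> v\<close> vanishes as well and v splits off
  as a block \<open>E_1\<close>, or the kernel U of \<open>\<phi> v\<close> is a hyperplane containing v.  In the second case \<open>\<phi>\<close>
  descends to U/v, of dimension two less, where the radical is again at most a line.  Lifting a
  normal basis of U/v and adding a vector outside U and a multiple of v lengthens the nilpotent
  block by two (\<open>normal_basis_exists\<close>).

  Uniqueness.  Let \<open>P S\<close> be the set of all y with \<open>\<phi> x y = 0\<close> for all x in S.  The sequence
  \<open>V, P V, P (P V), ...\<close> is carried along by every isomorphism.  For \<open>W_s\<close> it consists of coordinate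
  subspaces, and its m-th and (m+2)-nd terms agree exactly if \<open>m \<ge> n - s\<close>
  (\<open>perp_chain_W_stable\<close>).  Hence s can be read off.
\<close>

section \<open>Polynomial equations over an algebraically closed field\<close>

lemma trinomial_has_root:
  fixes a b :: "'k::alg_closed_field"
  assumes "n > 1"
  shows "\<exists>x. x ^ n + a * x + b = 0"
proof -
  have "degree [:b, a:] < degree (monom (1::'k) n)"
    using assms by (simp add: degree_monom_eq)
  then have "degree (monom 1 n + [:b, a:]) = n"
    by (subst degree_add_eq_left) (simp_all add: degree_monom_eq)
  then obtain x where "poly (monom 1 n + [:b, a:]) x = 0"
    using alg_closed_imp_poly_has_root[of "monom 1 n + [:b, a:]"] assms by auto
  then show ?thesis
    by (intro exI[of _ x]) (simp add: poly_monom algebra_simps)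
qed

lemma power_has_root:
  fixes c :: "'k::alg_closed_field"
  assumes "n > 1"
  shows "\<exists>x. x ^ n = c"
  using trinomial_has_root[OF assms, of 0 "- c"] by simp

text \<open>
  Suppose that a map F is additive, satisfies \<open>F (c v) = c^Q F v\<close>, and sends the last vector of a
  cyclic family \<open>v, F v, ..., F^m v\<close> to the combination with coefficients \<open>a\<close>.  The equations say that
  the combination with coefficients \<open>c\<close> is fixed by F.  They determine all \<open>c i\<close> as polynomials in
  \<open>t = c m\<close>, and the last one becomes a single equation \<open>P m (t) = t\<close>.  As \<open>P m\<close> is a nonzero
  multiple of \<open>t^Q\<close>, dividing by t leaves a nonconstant polynomial with constant term -1, whose
  roots are nonzero.
\<close>

lemma cyclic_fixed_coeffs:
  fixes a :: "nat \<Rightarrow> 'k::alg_closed_field"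
  assumes Q: "Q > 1" and nz: "\<exists>j\<le>m. a j \<noteq> 0"
  shows "\<exists>c. c 0 = a 0 * c m ^ Q \<and> (\<forall>i<m. c (Suc i) = c i ^ Q + a (Suc i) * c m ^ Q) \<and> c m \<noteq> 0"
proof -
  define P where "P = rec_nat (monom (a 0) Q) (\<lambda>i p. p ^ Q + monom (a (Suc i)) Q)"
  have P0: "P 0 = monom (a 0) Q" and PS: "P (Suc i) = P i ^ Q + monom (a (Suc i)) Q" for i
    by (simp_all add: P_def)
  have dvd: "monom 1 Q dvd P i" for i
  proof (induction i)
    case 0
    have "P 0 = monom 1 Q * [:a 0:]" by (simp add: P0 smult_monom)
    then show ?case by (metis dvd_triv_left)
  next
    case (Suc i)
    have "monom (a (Suc i)) Q = monom 1 Q * [:a (Suc i):]" by (simp add: smult_monom)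
    then have "monom 1 Q dvd monom (a (Suc i)) Q" by (metis dvd_triv_left)
    moreover have "P i dvd P i ^ Q" using Q by (intro dvd_power) auto
    ultimately show ?case using Suc unfolding PS by (meson dvd_add dvd_trans)
  qed
  have nonzero: "P i \<noteq> 0" if "\<exists>j\<le>i. a j \<noteq> 0" for i
    using that
  proof (induction i)
    case 0
    then show ?case by (simp add: P0)
  next
    case (Suc i)
    show ?case
    proof (cases "P i = 0")
      case True
      then have "a (Suc i) \<noteq> 0" using Suc by (metis le_Suc_eq)
      then show ?thesis using True Q by (simp add: PS power_0_left)
    next
      case False
      \<comment> \<open>The Q-th power has degree at least \<open>Q * Q\<close>, so the added monomial cannot cancel it.\<close>
      have "Q \<le> degree (P i)"
        using dvd_imp_degree_le[OF dvd False] by (simp add: degree_monom_eq)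
      then have "Q * Q \<le> degree (P i ^ Q)" by (simp add: degree_power_eq False mult.commute)
      moreover have "Q < Q * Q" using Q by simp
      ultimately have "degree (monom (a (Suc i)) Q) < degree (P i ^ Q)"
        using degree_monom_le[of "a (Suc i)" Q] by linarith
      then have "degree (P (Suc i)) = degree (P i ^ Q)"
        unfolding PS by (rule degree_add_eq_left)
      then have "degree (P (Suc i)) > 0" using \<open>Q * Q \<le> _\<close> \<open>Q < Q * Q\<close> by linarith
      then show ?thesis by auto
    qed
  qed
  \<comment> \<open>Division of the equation \<open>P m (t) = t\<close> by t excludes its trivial solution.\<close>
  obtain s where s: "P m = monom 1 Q * s" using dvd by (metis dvd_def)
  have "s \<noteq> 0" using nonzero[OF nz] s by auto
  have "Q = Suc (Suc (Q - 2))" using Q by simp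
  then obtain k where k: "Q = Suc (Suc k)" by blast
  define r where "r = monom 1 (Suc k) * s + [:-1:]"
  have "degree (monom 1 (Suc k) * s) = Suc k + degree s"
    using \<open>s \<noteq> 0\<close> by (subst degree_mult_eq) (auto simp: degree_monom_eq)
  then have "degree r > 0"
    unfolding r_def by (subst degree_add_eq_left) auto
  then obtain t where t: "poly r t = 0" using alg_closed_imp_poly_has_root by blast
  then have ts: "t ^ Suc k * poly s t = 1" by (simp add: r_def poly_monom)
  then have "t \<noteq> 0" by auto
  have "poly (P m) t = t * (t ^ Suc k * poly s t)" by (simp add: s poly_monom k)
  then have Pm: "poly (P m) t = t" by (simp only: ts mult_1_right)
  show ?thesis
  proof (intro exI conjI allI impI)
    show "poly (P 0) t = a 0 * poly (P m) t ^ Q"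
      unfolding Pm by (simp add: P0 poly_monom)
    show "poly (P (Suc i)) t = poly (P i) t ^ Q + a (Suc i) * poly (P m) t ^ Q" for i
      unfolding Pm by (simp add: PS poly_monom)
    show "poly (P m) t \<noteq> 0"
      unfolding Pm by (fact \<open>t \<noteq> 0\<close>)
  qed
qed

section \<open>Dimension of finitely spanned subspaces\<close>

locale subspace_dimension = vector_space scale
  for scale :: "'a::field \<Rightarrow> 'b::ab_group_add \<Rightarrow> 'b"  (infixr \<open>*s\<close> 75)
begin

text \<open>
  The subspaces live in a space that may be infinite-dimensional, where the function \<open>dim\<close> is also 0
  for subspaces without a finite basis.  The relation below keeps finiteness and dimension together.
\<close>

definition has_dim :: "'b set \<Rightarrow> nat \<Rightarrow> bool" where
  "has_dim V N \<longleftrightarrow> (\<exists>B. finite B \<and> independent B \<and> card B = N \<and> span B = V)"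

lemma has_dim_subspace: "has_dim V N \<Longrightarrow> subspace V"
  by (auto simp: has_dim_def)

lemma has_dim_independent:
  assumes "has_dim V N" "S \<subseteq> V" "independent S"
  shows "finite S" "card S \<le> N"
  using assms independent_span_bound[of _ S] by (auto simp: has_dim_def)

text \<open>
  A spanning set with at most as many elements as the dimension is a basis.  This allows bases to be
  modified freely: only spanning has to be checked for the new family.
\<close>

lemma has_dim_spanning:
  assumes "has_dim V N" "finite S" "S \<subseteq> V" "V \<subseteq> span S" "card S \<le> N"
  shows "independent S" "card S = N" "span S = V"
proof -
  obtain B where B: "B \<subseteq> S" "independent B" "S \<subseteq> span B"
    using maximal_independent_subset[of S] by auto
  obtain B0 where B0: "finite B0" "independent B0" "card B0 = N" "span B0 = V"
    using assms(1) by (auto simp: has_dim_def)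
  have "span S \<subseteq> span B" using B(3) by (simp add: span_minimal)
  then have "B0 \<subseteq> span B" using assms(4) B0(4) span_superset by blast
  then have "N \<le> card B"
    using independent_span_bound[of B B0] B0 finite_subset[OF B(1) assms(2)] by auto
  then have "B = S" using assms(2,5) B(1) by (meson card_seteq le_trans)
  with B \<open>N \<le> card B\<close> assms(5) show "independent S" "card S = N" by auto
  show "span S = V"
    using assms(3,4) has_dim_subspace[OF assms(1)] by (simp add: span_minimal subset_antisym)
qed

lemma has_dim_extend:
  assumes "has_dim V N" "v \<in> V" "v \<noteq> 0"
  obtains B where "v \<notin> B" "finite B" "independent (insert v B)" "card B = N - 1" "N > 0"
    "span (insert v B) = V"
proof -
  obtain B where B: "{v} \<subseteq> B" "B \<subseteq> V" "independent B" "V \<subseteq> span B"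
    using maximal_independent_subset_extend[of "{v}" V] assms by auto
  note fin = has_dim_independent[OF assms(1) B(2,3)]
  note sp = has_dim_spanning[OF assms(1) fin(1) B(2,4) fin(2)]
  have ins: "insert v (B - {v}) = B" using B(1) by auto
  have "N > 0" using sp(2) fin(1) B(1) by (auto simp: card_gt_0_iff)
  then show ?thesis
    using that[of "B - {v}"] sp fin B(1) unfolding ins by (simp add: card_Diff_singleton)
qed

text \<open>
  The subspace C stands for the quotient of V by the line through v, which would need another type.
\<close>

lemma complement_of_vector:
  assumes "has_dim V N" "v \<in> V" "v \<noteq> 0"
  obtains C where "has_dim C (N - 1)" "C \<subseteq> V" "v \<notin> C" "N > 0" "\<And>x. x \<in> V \<Longrightarrow> \<exists>k. x - k *s v \<in> C"
proof -
  obtain B where B: "v \<notin> B" "finite B" "independent (insert v B)" "card B = N - 1" "N > 0"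
    "span (insert v B) = V" using has_dim_extend[OF assms] .
  show ?thesis
  proof (rule that[of "span B"])
    show "has_dim (span B) (N - 1)"
      using B independent_mono[OF B(3)] by (auto simp: has_dim_def)
    show "span B \<subseteq> V" using B(6) span_mono by blast
    show "v \<notin> span B" using B(1,3) by (simp add: independent_insert)
    show "\<exists>k. x - k *s v \<in> span B" if "x \<in> V" for x
      using that B(6) span_breakdown_eq by blast
  qed (fact B)
qed

lemma in_span_image_lessThan:
  assumes "x \<in> span (b ` {..<N::nat})"
  shows "\<exists>a. x = (\<Sum>i<N. a i *s b i)"
  using assms
proof (induction N arbitrary: x)
  case 0
  then show ?case by simp
next
  case (Suc N)
  then have "x \<in> span (insert (b N) (b ` {..<N}))" by (simp add: lessThan_Suc)
  then obtain k where "x - k *s b N \<in> span (b ` {..<N})"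
    by (auto simp: span_breakdown_eq)
  then obtain a where a: "x - k *s b N = (\<Sum>i<N. a i *s b i)" using Suc.IH by blast
  have "x = (\<Sum>i<Suc N. (a(N := k)) i *s b i)"
    by (simp add: a[symmetric])
  then show ?case by blast
qed

lemma has_dim_enumerate:
  assumes "has_dim V N"
  obtains b where "span (b ` {..<N}) = V" "\<And>c i. (\<Sum>i<N. c i *s b i) = 0 \<Longrightarrow> i < N \<Longrightarrow> c i = 0"
proof -
  obtain B where B: "finite B" "independent B" "card B = N" "span B = V"
    using assms by (auto simp: has_dim_def)
  obtain b where b: "bij_betw b {..<N} B"
    using B(1,3) ex_bij_betw_nat_finite[of B] by (auto simp: atLeast0LessThan)
  have im: "b ` {..<N} = B" using b by (simp add: bij_betw_def)
  show ?thesis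
  proof (rule that[of b])
    show "span (b ` {..<N}) = V" using im B by simp
    fix c i assume *: "(\<Sum>i<N. c i *s b i) = 0" "i < N"
    have "(\<Sum>x\<in>B. c (inv_into {..<N} b x) *s x) = (\<Sum>i<N. c (inv_into {..<N} b (b i)) *s b i)"
      by (rule sum.reindex_bij_betw[OF b, symmetric])
    also have "\<dots> = (\<Sum>i<N. c i *s b i)"
      using b by (intro sum.cong) (auto simp: bij_betw_def)
    finally have "(\<Sum>x\<in>B. c (inv_into {..<N} b x) *s x) = 0" using * by simp
    then have "c (inv_into {..<N} b (b i)) = 0"
      using independentD[OF B(2,1) order_refl, of "\<lambda>x. c (inv_into {..<N} b x)"] im *(2) by blast
    then show "c i = 0" using b *(2) by (simp add: bij_betw_def)
  qed
qed

end

section \<open>Forms that are linear in one and q-semilinear in the other argument\<close>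

locale frobenius_form = subspace_dimension scale
  for scale :: "'k::alg_closed_field \<Rightarrow> 'v::ab_group_add \<Rightarrow> 'v"  (infixr \<open>*s\<close> 75) +
  fixes \<phi> :: "'v \<Rightarrow> 'v \<Rightarrow> 'k" and q :: nat
  assumes q_gt_1: "q > 1"
    and frob_add: "(a + b) ^ q = a ^ q + (b :: 'k) ^ q"
    and add_left: "\<phi> (x + y) z = \<phi> x z + \<phi> y z"
    and scale_left: "\<phi> (c *s x) z = c * \<phi> x z"
    and add_right: "\<phi> x (y + z) = \<phi> x y + \<phi> x z"
    and scale_right: "\<phi> x (c *s y) = c ^ q * \<phi> x y"
begin

lemma frob_0 [simp]: "(0 :: 'k) ^ q = 0"
  using q_gt_1 by simp

lemma frob_minus: "(- a) ^ q = - ((a :: 'k) ^ q)"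
  using frob_add[of a "- a"] by (simp add: eq_neg_iff_add_eq_0 add.commute)

lemma frob_diff: "(a - b) ^ q = a ^ q - (b :: 'k) ^ q"
  using frob_add[of a "- b"] by (simp add: frob_minus)

lemma frob_inject: "a ^ q = b ^ q \<longleftrightarrow> a = (b :: 'k)"
  using frob_diff[of a b] q_gt_1 by auto

lemma frob_sum: "(\<Sum>i\<in>I. f i) ^ q = (\<Sum>i\<in>I. (f i :: 'k) ^ q)"
  by (induction I rule: infinite_finite_induct) (simp_all add: frob_add)

lemma frob_root: "\<exists>x. x ^ q = (c :: 'k)"
  by (rule power_has_root[OF q_gt_1])

lemma zero_left [simp]: "\<phi> 0 x = 0"
  using scale_left[of 0 0 x] by simp

lemma zero_right [simp]: "\<phi> x 0 = 0"
  using scale_right[of x 0 0] by simp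

lemma minus_left: "\<phi> (- x) y = - \<phi> x y"
  using add_left[of x "- x" y] by (simp add: eq_neg_iff_add_eq_0 add.commute)

lemma minus_right: "\<phi> x (- y) = - \<phi> x y"
  using add_right[of x y "- y"] by (simp add: eq_neg_iff_add_eq_0 add.commute)

lemma diff_left: "\<phi> (x - y) z = \<phi> x z - \<phi> y z"
  using add_left[of x "- y" z] by (simp add: minus_left)

lemma diff_right: "\<phi> x (y - z) = \<phi> x y - \<phi> x z"
  using add_right[of x y "- z"] by (simp add: minus_right)

lemmas form_simps = add_left add_right scale_left scale_right diff_left diff_right

lemma sum_left: "\<phi> (\<Sum>i\<in>I. c i *s b i) x = (\<Sum>i\<in>I. c i * \<phi> (b i) x)"
  by (induction I rule: infinite_finite_induct) (simp_all add: add_left scale_left)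

lemma sum_right: "\<phi> x (\<Sum>i\<in>I. c i *s b i) = (\<Sum>i\<in>I. c i ^ q * \<phi> x (b i))"
  by (induction I rule: infinite_finite_induct) (simp_all add: add_right scale_right)

definition frob_linear :: "('v \<Rightarrow> 'k) \<Rightarrow> bool" where
  "frob_linear f \<longleftrightarrow> (\<forall>x y. f (x + y) = f x + f y) \<and> (\<forall>c x. f (c *s x) = c ^ q * f x)"

lemma frob_linear_form: "frob_linear (\<phi> x)"
  by (simp add: frob_linear_def form_simps)

lemma frob_linear_diff_scale:
  assumes "frob_linear f" shows "f (x - c *s y) = f x - c ^ q * f y"
proof -
  have "f (x - c *s y + c *s y) = f (x - c *s y) + c ^ q * f y"
    using assms unfolding frob_linear_def by metis
  then show ?thesis by simp
qed

lemma frob_linear_sum: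
  assumes "frob_linear f" shows "f (\<Sum>i\<in>I. c i *s b i) = (\<Sum>i\<in>I. c i ^ q * f (b i))"
proof -
  have "f 0 = 0" using frob_linear_diff_scale[OF assms, of 0 1 0] by simp
  then show ?thesis
    using assms by (induction I rule: infinite_finite_induct) (simp_all add: frob_linear_def)
qed

lemma kernel_subspace:
  assumes "frob_linear f" "subspace V" shows "subspace {x \<in> V. f x = 0}"
proof -
  have "f 0 = 0" using frob_linear_diff_scale[OF assms(1), of 0 1 0] by simp
  then show ?thesis
    using assms unfolding subspace_def frob_linear_def by simp
qed

text \<open>
  Semilinear functionals have hyperplanes as kernels because q-th roots exist: a basis
  containing g is moved into the kernel by subtracting multiples of g from the other vectors.
\<close>

lemma kernel_has_dim:
  assumes V: "has_dim V N" and f: "frob_linear f" and g: "g \<in> V" "f g \<noteq> 0"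
  shows "has_dim {x \<in> V. f x = 0} (N - 1)" "N > 0"
proof -
  let ?U = "{x \<in> V. f x = 0}"
  have f0: "f 0 = 0" using frob_linear_diff_scale[OF f, of 0 1 0] by simp
  have "g \<noteq> 0" using g f0 by auto
  then obtain B where B: "g \<notin> B" "finite B" "independent (insert g B)" "card B = N - 1" "N > 0"
    "span (insert g B) = V" using has_dim_extend[OF V g(1)] by blast
  have sV: "subspace V" by (rule has_dim_subspace[OF V])
  have BV: "B \<subseteq> V" using B(6) span_superset by blast
  have "\<forall>b. \<exists>r. r ^ q = f b / f g" using frob_root by blast
  then obtain r where r: "\<And>b. r b ^ q = f b / f g" by metis
  define B1 where "B1 = (\<lambda>b. b - r b *s g) ` B"
  have B1U: "B1 \<subseteq> ?U"
    using BV g by (auto simp: B1_def frob_linear_diff_scale[OF f] r intro!: subspace_diff[OF sV] subspace_scale[OF sV])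
  have fin: "finite (insert g B1)" using B(2) by (simp add: B1_def)
  have sub: "insert g B1 \<subseteq> V" using B1U g by auto
  have "b \<in> span (insert g B1)" if "b \<in> B" for b
  proof -
    have "(b - r b *s g) + r b *s g \<in> span (insert g B1)"
      using that by (intro span_add span_scale span_base) (auto simp: B1_def)
    then show ?thesis by simp
  qed
  then have sp: "V \<subseteq> span (insert g B1)"
    using B(6) span_minimal[of "insert g B" "span (insert g B1)"] span_base[of g "insert g B1"] by auto
  have "card B1 \<le> N - 1" using card_image_le[OF B(2)] B(4) by (simp add: B1_def)
  then have "card (insert g B1) \<le> N"
    using card_insert_le_m1[of N B1 g] B(5) by simp
  note bas = has_dim_spanning[OF V fin sub sp this]
  have gB1: "g \<notin> B1" using B1U g by auto
  have "span B1 = ?U"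
  proof
    show "span B1 \<subseteq> ?U" by (rule span_minimal[OF B1U kernel_subspace[OF f sV]])
    show "?U \<subseteq> span B1"
    proof
      fix x assume x: "x \<in> ?U"
      then have "x \<in> span (insert g B1)" using bas(3) by simp
      then obtain k where k: "x - k *s g \<in> span B1" by (auto simp: span_breakdown_eq)
      then have "f (x - k *s g) = 0" using \<open>span B1 \<subseteq> ?U\<close> by auto
      then have "k ^ q * f g = 0" using x by (simp add: frob_linear_diff_scale[OF f])
      then have "k = 0" using g q_gt_1 by simp
      then show "x \<in> span B1" using k by simp
    qed
  qed
  moreover have "independent B1" using bas(1) by (rule independent_mono) auto
  moreover have "card B1 = N - 1" using bas(2) gB1 fin by simp
  ultimately show "has_dim ?U (N - 1)" using fin by (auto simp: has_dim_def)
  show "N > 0" by (fact B)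
qed

definition nondegenerate_on :: "'v set \<Rightarrow> bool" where
  "nondegenerate_on V \<longleftrightarrow> (\<forall>y\<in>V. (\<forall>x\<in>V. \<phi> x y = 0) \<longrightarrow> y = 0)"

text \<open>
  The Gram matrix of \<open>\<phi>\<close> in a basis is nonsingular: a vector in its kernel is, entry by entry, the
  q-th power of the coordinates of a vector in the right radical.  The transposed system then has a
  solution for every right-hand side.
\<close>

lemma nondegenerate_represents:
  assumes V: "has_dim V N" and nd: "nondegenerate_on V" and f: "frob_linear f"
  obtains w where "w \<in> V" "\<And>x. x \<in> V \<Longrightarrow> \<phi> w x = f x"
proof -
  obtain b where b: "span (b ` {..<N}) = V"
    and indep: "\<And>c i. (\<Sum>i<N. c i *s b i) = 0 \<Longrightarrow> i < N \<Longrightarrow> c i = 0"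
    using has_dim_enumerate[OF V] by blast
  have comb: "(\<Sum>i<N. c i *s b i) \<in> V" for c
    unfolding b[symmetric] by (intro span_sum span_scale span_base) auto
  define A where "A = mat N N (\<lambda>(i, j). \<phi> (b i) (b j))"
  have A: "A \<in> carrier_mat N N" by (simp add: A_def)
  have "det A \<noteq> 0"
  proof
    assume "det A = 0"
    then obtain y where y: "y \<in> carrier_vec N" "y \<noteq> 0\<^sub>v N" "A *\<^sub>v y = 0\<^sub>v N"
      using det_0_iff_vec_prod_zero_field[OF A] by auto
    have "\<forall>j. \<exists>r. r ^ q = vec_index y j" using frob_root by blast
    then obtain r where r: "\<And>j. r j ^ q = vec_index y j" by metis
    define z where "z = (\<Sum>j<N. r j *s b j)"
    have *: "\<phi> (b i) z = 0" if "i < N" for i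
    proof -
      have "\<phi> (b i) z = (\<Sum>j<N. vec_index y j * \<phi> (b i) (b j))" by (simp add: z_def sum_right r)
      also have "\<dots> = vec_index (A *\<^sub>v y) i"
        using that y(1) by (simp add: A_def scalar_prod_def atLeast0LessThan mult.commute)
      finally show ?thesis using y(3) that by simp
    qed
    have "\<phi> x z = 0" if x: "x \<in> V" for x
    proof -
      obtain a where "x = (\<Sum>i<N. a i *s b i)" using x in_span_image_lessThan[of x b N] b by auto
      then show ?thesis using * by (simp add: sum_left)
    qed
    then have "z = 0" using nd comb[of r] by (auto simp: nondegenerate_on_def z_def)
    then have "r j = 0" if "j < N" for j using indep[of r] that by (simp add: z_def)
    then have "vec_index y j = 0" if "j < N" for j using r[of j] that by simp
    then have "y = 0\<^sub>v N" using y(1) by auto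
    with y(2) show False by simp
  qed
  then have "det (transpose_mat A) \<noteq> 0" using det_transpose[OF A] by simp
  then obtain B where B: "B \<in> carrier_mat N N" "transpose_mat A * B = 1\<^sub>m N"
    using det_non_zero_imp_unit[of "transpose_mat A" N "()"] A
    by (auto simp: Units_def ring_mat_def)
  define t where "t = vec N (\<lambda>i. f (b i))"
  define u where "u = B *\<^sub>v t"
  have t: "t \<in> carrier_vec N" and u: "u \<in> carrier_vec N" using B by (auto simp: t_def u_def)
  have Au: "transpose_mat A *\<^sub>v u = t"
    unfolding u_def using A B t by (subst assoc_mult_mat_vec[symmetric, of _ N N _ N]) auto
  define w where "w = (\<Sum>i<N. vec_index u i *s b i)"
  have wb: "\<phi> w (b j) = f (b j)" if "j < N" for j
  proof -
    have "\<phi> w (b j) = (\<Sum>i<N. vec_index u i * \<phi> (b i) (b j))" by (simp add: w_def sum_left)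
    also have "\<dots> = vec_index (transpose_mat A *\<^sub>v u) j"
      using that u by (simp add: A_def scalar_prod_def atLeast0LessThan mult.commute)
    finally show ?thesis using that by (simp add: Au t_def)
  qed
  show ?thesis
  proof (rule that[of w])
    show "w \<in> V" unfolding w_def by (rule comb)
    fix x assume "x \<in> V"
    then obtain a where "x = (\<Sum>i<N. a i *s b i)" using in_span_image_lessThan[of x b N] b by auto
    then show "\<phi> w x = f x" using wb by (simp add: sum_right frob_linear_sum[OF f])
  qed
qed

section \<open>Nondegenerate forms\<close>

text \<open>
  Nondegeneracy yields a map F with \<open>\<phi> (F v) x = (\<phi> x v)^q\<close>, which is semilinear with exponent
  \<open>q * q\<close> because \<open>\<phi>\<close> is q-semilinear on the right; a fixed point of F is what is wanted.  In the
  sequence \<open>v0, F v0, F (F v0), ...\<close> of nonzero vectors take the first one that depends on its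
  predecessors, and look for a fixed point in their span.
\<close>

lemma hermitian_vector_exists:
  assumes V: "has_dim V N" and nd: "nondegenerate_on V" and "N > 0"
  obtains v where "v \<in> V" "v \<noteq> 0" "\<And>x. x \<in> V \<Longrightarrow> \<phi> v x = \<phi> x v ^ q"
proof -
  have sV: "subspace V" by (rule has_dim_subspace[OF V])
  have ex: "\<exists>w\<in>V. \<forall>x\<in>V. \<phi> w x = \<phi> x v ^ q" for v
  proof -
    have "frob_linear (\<lambda>x. \<phi> x v ^ q)"
      by (simp add: frob_linear_def form_simps frob_add power_mult_distrib)
    then show ?thesis by (rule nondegenerate_represents[OF V nd]) auto
  qed
  define F where "F v = (SOME w. w \<in> V \<and> (\<forall>x\<in>V. \<phi> w x = \<phi> x v ^ q))" for v
  have F: "F v \<in> V" "x \<in> V \<Longrightarrow> \<phi> (F v) x = \<phi> x v ^ q" for v x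
    using ex[of v] someI_ex[of "\<lambda>w. w \<in> V \<and> (\<forall>x\<in>V. \<phi> w x = \<phi> x v ^ q)"] unfolding F_def by blast+
  obtain v0 where v0: "v0 \<in> V" "v0 \<noteq> 0"
  proof -
    obtain B where "finite B" "independent B" "card B = N" "span B = V"
      using V by (auto simp: has_dim_def)
    then show ?thesis using that \<open>N > 0\<close> dependent_zero span_base
      by (metis card_gt_0_iff ex_in_conv)
  qed
  define v where "v = (\<lambda>i. (F ^^ i) v0)"
  have vS: "v (Suc i) = F (v i)" for i by (simp add: v_def)
  have vV: "v i \<in> V" for i using v0 F(1) by (cases i) (simp_all add: v_def)
  have vnz: "v i \<noteq> 0" for i
  proof (induction i)
    case 0 then show ?case using v0 by (simp add: v_def)
  next
    case (Suc i)
    then obtain x where "x \<in> V" "\<phi> x (v i) \<noteq> 0" using nd vV unfolding nondegenerate_on_def by blast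
    then have "\<phi> (v (Suc i)) x \<noteq> 0" using q_gt_1 by (simp add: vS F(2))
    then show ?case by auto
  qed
  have "\<exists>m. v m \<in> span (v ` {..<m})"
  proof (rule ccontr)
    assume "\<not> ?thesis"
    then have *: "v m \<notin> span (v ` {..<m})" for m by blast
    have "independent (v ` {..<m}) \<and> card (v ` {..<m}) = m" for m
    proof (induction m)
      case (Suc m)
      have "v m \<notin> v ` {..<m}" using *[of m] span_base[of "v m" "v ` {..<m}"] by auto
      then show ?case using Suc *[of m] by (simp add: lessThan_Suc independent_insert)
    qed (simp add: independent_empty)
    then show False using has_dim_independent[OF V, of "v ` {..<Suc N}"] vV by (metis Suc_n_not_le_n image_subsetI)
  qed
  \<comment> \<open>The minimality of M expresses that the vectors before \<open>v M\<close> are independent.\<close>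
  then obtain M where M: "v M \<in> span (v ` {..<M})" "\<And>i. i < M \<Longrightarrow> v i \<notin> span (v ` {..<i})"
    using exists_least_iff[of "\<lambda>m. v m \<in> span (v ` {..<m})"] by auto
  obtain m where m: "M = Suc m" using M(1) vnz by (cases M) auto
  from in_span_image_lessThan[OF M(1)] obtain a where a: "v (Suc m) = (\<Sum>i<Suc m. a i *s v i)"
    unfolding m ..
  have nz: "\<exists>j\<le>m. a j \<noteq> 0"
  proof (rule ccontr)
    assume "\<not> ?thesis"
    then have "v (Suc m) = 0" unfolding a by (intro sum.neutral) (auto simp: less_Suc_eq_le)
    with vnz show False by blast
  qed
  have Q: "q * q > 1" by (rule less_1_mult[OF q_gt_1 q_gt_1])
  from cyclic_fixed_coeffs[OF Q nz] obtain c where c: "c 0 = a 0 * c m ^ (q * q) \<and>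
    (\<forall>i<m. c (Suc i) = c i ^ (q * q) + a (Suc i) * c m ^ (q * q)) \<and> c m \<noteq> 0" ..
  then have c0: "c 0 = a 0 * c m ^ (q * q)"
    and cS: "\<And>i. i < m \<Longrightarrow> c (Suc i) = c i ^ (q * q) + a (Suc i) * c m ^ (q * q)" and cm: "c m \<noteq> 0"
    by auto
  define w where "w = (\<Sum>i<Suc m. c i *s v i)"
  show ?thesis
  proof (rule that[of w])
    show "w \<in> V" unfolding w_def using vV by (intro subspace_sum[OF sV] subspace_scale[OF sV]) auto
    show "w \<noteq> 0"
    proof
      assume "w = 0"
      have "c m *s v m = - (\<Sum>i<m. c i *s v i)" using \<open>w = 0\<close>
        by (simp add: w_def eq_neg_iff_add_eq_0 add.commute)
      then have "v m = inverse (c m) *s (- (\<Sum>i<m. c i *s v i))"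
        using cm by (metis scale_scale left_inverse scale_one)
      moreover have "inverse (c m) *s (- (\<Sum>i<m. c i *s v i)) \<in> span (v ` {..<m})"
        by (intro span_scale span_neg span_sum span_base) auto
      ultimately show False using M(2)[of m] m by simp
    qed
    fix x assume x: "x \<in> V"
    have av: "\<phi> (v (Suc m)) x = (\<Sum>i<Suc m. a i * \<phi> (v i) x)"
      by (simp only: a sum_left)
    have "\<phi> x w ^ q = (\<Sum>i<Suc m. c i ^ (q * q) * \<phi> (v (Suc i)) x)"
      by (simp only: w_def sum_right frob_sum power_mult_distrib power_mult[symmetric] vS F(2)[OF x])
    also have "\<dots> = (\<Sum>i<m. c i ^ (q * q) * \<phi> (v (Suc i)) x) + c m ^ (q * q) * (\<Sum>i<Suc m. a i * \<phi> (v i) x)"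
      unfolding av[symmetric] by (rule sum.lessThan_Suc)
    also have "\<dots> = a 0 * c m ^ (q * q) * \<phi> (v 0) x
        + (\<Sum>i<m. (c i ^ (q * q) + a (Suc i) * c m ^ (q * q)) * \<phi> (v (Suc i)) x)"
      by (simp add: sum.lessThan_Suc_shift sum.distrib sum_distrib_left algebra_simps del: sum.lessThan_Suc)
    also have "\<dots> = (\<Sum>i<Suc m. c i * \<phi> (v i) x)"
      by (simp add: sum.lessThan_Suc_shift c0[symmetric] cS[symmetric] del: sum.lessThan_Suc)
    finally show "\<phi> w x = \<phi> x w ^ q" by (simp only: w_def sum_left)
  qed
qed

lemma subset_span_complement:
  assumes "\<And>x. x \<in> V \<Longrightarrow> \<exists>k. x - k *s v \<in> C" "C \<subseteq> span S" "v \<in> span S"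
  shows "V \<subseteq> span S"
proof
  fix x assume "x \<in> V"
  then obtain k where "x - k *s v \<in> C" using assms(1) by auto
  then have "(x - k *s v) + k *s v \<in> span S" using assms(2,3) by (intro span_add span_scale) auto
  then show "x \<in> span S" by simp
qed

lemma kernel_complement:
  assumes "frob_linear f" "subspace V" "g \<in> V" "f g \<noteq> 0" "x \<in> V"
  shows "\<exists>k. x - k *s g \<in> {x \<in> V. f x = 0}"
proof -
  obtain k where "k ^ q = f x / f g" using frob_root by auto
  then have "x - k *s g \<in> {x \<in> V. f x = 0}"
    using assms by (simp add: frob_linear_diff_scale subspace_diff subspace_scale)
  then show ?thesis ..
qed

lemma shifted_basis_span:
  assumes "v \<in> span S" "\<And>i. i < M \<Longrightarrow> b i + a i *s v \<in> span S"
  shows "span (b ` {..<M::nat}) \<subseteq> span S"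
proof (rule span_minimal)
  show "b ` {..<M} \<subseteq> span S"
  proof
    fix x assume "x \<in> b ` {..<M}"
    then obtain i where "i < M" "x = b i" by auto
    then have "(b i + a i *s v) - a i *s v \<in> span S"
      using assms by (intro span_diff span_scale) auto
    then show "x \<in> span S" using \<open>x = b i\<close> by simp
  qed
qed simp

text \<open>
  Induction on the dimension.  A Hermitian vector v with \<open>\<phi> v v \<noteq> 0\<close> is normalised and split off,
  because its orthogonal space does not depend on the side.  If \<open>\<phi> v v = 0\<close>, the orthogonal space U
  contains v, and the induction hypothesis applies to a complement C of v in U.  Let b be an
  orthonormal basis of C, and let g satisfy \<open>\<phi> v g = \<phi> g v = 1\<close>.  Replacing \<open>b i\<close> by
  \<open>b i + a i v\<close> and g by \<open>g + \<Sum>i. h i b i\<close> makes all products between the two kinds of vectors zero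
  if a and h solve the equations on both sides, and eliminating \<open>a i\<close> leaves one separable
  equation for each \<open>h i\<close>.  The remaining plane is spanned by v and g.
\<close>

lemma orthonormal_basis_exists:
  assumes "has_dim V N" "nondegenerate_on V"
  shows "\<exists>b. span (b ` {..<N}) = V \<and> (\<forall>i<N. \<forall>j<N. \<phi> (b i) (b j) = (if i = j then 1 else 0))"
  using assms
proof (induction N arbitrary: V rule: less_induct)
  case (less N)
  note V = less.prems(1) and nd = less.prems(2)
  have sV: "subspace V" by (rule has_dim_subspace[OF V])
  show ?case
  proof (cases "N = 0")
    case True
    then show ?thesis using V by (auto simp: has_dim_def)
  next
    case False
    then obtain v where v: "v \<in> V" "v \<noteq> 0" and herm: "\<And>x. x \<in> V \<Longrightarrow> \<phi> v x = \<phi> x v ^ q"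
      using hermitian_vector_exists[OF V nd] by auto
    show ?thesis
    proof (cases "\<phi> v v = 0")
      case False
      obtain l where l: "l ^ Suc q = inverse (\<phi> v v)" using power_has_root[of "Suc q"] q_gt_1 by auto
      define v1 where "v1 = l *s v"
      have v1: "v1 \<in> V" using v by (simp add: v1_def subspace_scale[OF sV])
      have "\<phi> v1 v1 = l ^ Suc q * \<phi> v v" by (simp add: v1_def form_simps)
      then have v11: "\<phi> v1 v1 = 1" unfolding l using False by simp
      have perp: "\<phi> x v1 = 0" if "x \<in> V" "\<phi> v1 x = 0" for x
      proof (cases "l = 0")
        case False
        then have "\<phi> v x = 0" using that(2) by (simp add: v1_def form_simps)
        then show ?thesis using herm[OF that(1)] q_gt_1 by (simp add: v1_def form_simps)
      qed (simp add: v1_def)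
      let ?U = "{x \<in> V. \<phi> v1 x = 0}"
      have U: "has_dim ?U (N - 1)"
        using kernel_has_dim(1)[OF V frob_linear_form v1] v11 by simp
      have comp: "\<exists>k. x - k *s v1 \<in> ?U" if "x \<in> V" for x
        using kernel_complement[OF frob_linear_form sV v1 _ that] v11 by simp
      have "nondegenerate_on ?U"
        unfolding nondegenerate_on_def
      proof (intro ballI impI)
        fix y assume y: "y \<in> ?U" "\<forall>x\<in>?U. \<phi> x y = 0"
        have "\<phi> x y = 0" if x: "x \<in> V" for x
        proof -
          obtain k where "x - k *s v1 \<in> ?U" using comp[OF x] by blast
          then have "\<phi> (x - k *s v1) y = 0" using y(2) by blast
          then show ?thesis using y(1) by (simp add: form_simps)
        qed
        then show "y = 0" using nd y(1) by (simp add: nondegenerate_on_def)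
      qed
      then obtain b where b: "span (b ` {..<N - 1}) = ?U"
        "\<And>i j. i < N - 1 \<Longrightarrow> j < N - 1 \<Longrightarrow> \<phi> (b i) (b j) = (if i = j then 1 else 0)"
        using less.IH[OF _ U] \<open>N \<noteq> 0\<close> by auto
      define b' where "b' = b(N - 1 := v1)"
      have bU: "b i \<in> ?U" if "i < N - 1" for i
        using that b(1) span_base[of "b i" "b ` {..<N - 1}"] by auto
      have im: "b' ` {..<N} = insert v1 (b ` {..<N - 1})"
        using \<open>N \<noteq> 0\<close> by (auto simp: b'_def image_iff)
      have "span (b' ` {..<N}) = V"
      proof
        show "span (b' ` {..<N}) \<subseteq> V"
          unfolding im using bU v1 by (intro span_minimal sV) auto
        have "?U \<subseteq> span (b' ` {..<N})" unfolding b(1)[symmetric] im by (rule span_mono) auto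
        moreover have "v1 \<in> span (b' ` {..<N})" unfolding im by (rule span_base) simp
        ultimately show "V \<subseteq> span (b' ` {..<N})" using subset_span_complement[of V v1 ?U] comp by auto
      qed
      moreover have "\<phi> (b' i) (b' j) = (if i = j then 1 else 0)" if "i < N" "j < N" for i j
        using that b(2)[of i j] bU[of i] bU[of j] v11 perp by (auto simp: b'_def)
      ultimately show ?thesis by blast
    next
      case True
      obtain x where x: "x \<in> V" "\<phi> x v \<noteq> 0" using nd v by (auto simp: nondegenerate_on_def)
      then have "\<phi> v x \<noteq> 0" using herm by simp
      obtain r where r: "r ^ q = inverse (\<phi> v x)" using frob_root by auto
      define g where "g = r *s x"
      have g: "g \<in> V" using x by (simp add: g_def subspace_scale[OF sV])
      have vg: "\<phi> v g = 1" using \<open>\<phi> v x \<noteq> 0\<close> by (simp add: g_def form_simps r)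
      have gv: "\<phi> g v = 1" using herm[OF g] vg frob_inject[of "\<phi> g v" 1] by simp
      let ?U = "{x \<in> V. \<phi> v x = 0}"
      have U: "has_dim ?U (N - 1)"
        using kernel_has_dim(1)[OF V frob_linear_form g] vg by simp
      have compU: "\<exists>k. x - k *s g \<in> ?U" if "x \<in> V" for x
        using kernel_complement[OF frob_linear_form sV g _ that] vg by simp
      have perp: "\<phi> x v = 0" if "x \<in> ?U" for x
        using that herm[of x] q_gt_1 by simp
      have vU: "v \<in> ?U" using v True by simp
      obtain C where C: "has_dim C (N - 1 - 1)" "C \<subseteq> ?U" "v \<notin> C" "N - 1 > 0"
        and compC: "\<And>x. x \<in> ?U \<Longrightarrow> \<exists>k. x - k *s v \<in> C"
        using complement_of_vector[OF U vU v(2)] by blast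
      define M where "M = N - 2"
      have N: "N = Suc (Suc M)" using C(4) by (simp add: M_def)
      have sC: "subspace C" by (rule has_dim_subspace[OF C(1)])
      have "nondegenerate_on C"
        unfolding nondegenerate_on_def
      proof (intro ballI impI)
        fix y assume y: "y \<in> C" "\<forall>x\<in>C. \<phi> x y = 0"
        have yV: "y \<in> V" "\<phi> v y = 0" using y(1) C(2) by auto
        \<comment> \<open>A correction by a multiple of v moves y into the radical of the whole space.\<close>
        obtain t where t: "t ^ q = \<phi> g y" using frob_root by auto
        define y' where "y' = y - t *s v"
        have y'V: "y' \<in> V" using yV v by (simp add: y'_def subspace_diff[OF sV] subspace_scale[OF sV])
        have "\<phi> x y' = 0" if x: "x \<in> V" for x
        proof -
          obtain k where k: "x - k *s g \<in> ?U" using compU[OF x] by blast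
          obtain m where m: "x - k *s g - m *s v \<in> C" using compC[OF k] by blast
          then have "\<phi> (x - k *s g - m *s v) y = 0" using y(2) by blast
          moreover have "\<phi> (x - k *s g) v = 0" by (rule perp[OF k])
          ultimately show ?thesis using yV t gv by (simp add: y'_def form_simps)
        qed
        then have "y' = 0" using nd y'V by (simp add: nondegenerate_on_def)
        then have yt: "y = t *s v" by (simp add: y'_def)
        show "y = 0"
        proof (cases "t = 0")
          case False
          have "inverse t *s y \<in> C" using y(1) by (rule subspace_scale[OF sC])
          then show ?thesis using C(3) False by (simp add: yt)
        qed (simp add: yt)
      qed
      moreover have "M < N" "has_dim C M" using C(1) N by auto
      ultimately obtain b where b: "span (b ` {..<M}) = C"
        "\<And>i j. i < M \<Longrightarrow> j < M \<Longrightarrow> \<phi> (b i) (b j) = (if i = j then 1 else 0)"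
        using less.IH[of M C] by auto
      have bC: "b i \<in> C" if "i < M" for i
        using that b(1) span_base[of "b i" "b ` {..<M}"] by auto
      have bV: "b i \<in> V" and vb: "\<phi> v (b i) = 0" and bv: "\<phi> (b i) v = 0" if "i < M" for i
        using bC[OF that] C(2) perp by auto
      \<comment> \<open>This is the condition \<open>\<phi> g2 (b1 i) = 0\<close> below, after \<open>a i\<close> has been chosen such that
        \<open>\<phi> (b1 i) g2 = 0\<close>.\<close>
      have "\<exists>h. h ^ (q * q) + (- 1) * h + (\<phi> (b i) g ^ q - \<phi> g (b i)) = 0" for i
        by (rule trinomial_has_root[OF less_1_mult[OF q_gt_1 q_gt_1]])
      then obtain h where h: "\<And>i. h i ^ (q * q) + (- 1) * h i + (\<phi> (b i) g ^ q - \<phi> g (b i)) = 0"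
        by metis
      define a where "a i = - \<phi> (b i) g - h i ^ q" for i
      define b1 where "b1 i = b i + a i *s v" for i
      define H where "H = (\<Sum>i<M. h i *s b i)"
      define g1 where "g1 = g + H"
      have HV: "H \<in> V" unfolding H_def using bV by (intro subspace_sum[OF sV] subspace_scale[OF sV]) auto
      have vH: "\<phi> v H = 0" by (simp add: H_def sum_right vb)
      have Hv: "\<phi> H v = 0" by (simp add: H_def sum_left bv)
      have bH: "\<phi> (b i) H = h i ^ q" if "i < M" for i
      proof -
        have "\<phi> (b i) H = (\<Sum>j<M. if i = j then h j ^ q else 0)"
          unfolding H_def sum_right using that by (intro sum.cong) (auto simp: b(2))
        then show ?thesis using that by simp
      qed
      have Hb: "\<phi> H (b i) = h i" if "i < M" for i
      proof -
        have "\<phi> H (b i) = (\<Sum>j<M. if i = j then h j else 0)"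
          unfolding H_def sum_left using that by (intro sum.cong) (auto simp: b(2))
        then show ?thesis using that by simp
      qed
      \<comment> \<open>The choice of \<open>\<beta>\<close> gives \<open>\<phi> g2 g2 = 1\<close>; then \<open>v - g2\<close> is orthogonal to \<open>g2\<close> on both sides and
        has square -1.\<close>
      obtain \<beta> where \<beta>: "\<beta> ^ q + 1 * \<beta> + (\<phi> g1 g1 - 1) = 0" using trinomial_has_root[OF q_gt_1] by blast
      define g2 where "g2 = g1 + \<beta> *s v"
      obtain l where l: "l ^ Suc q = (- 1 :: 'k)" using power_has_root[of "Suc q"] q_gt_1 by auto
      have "l \<noteq> 0" using l by auto
      define v2 where "v2 = l *s (v - g2)"
      have vg2: "\<phi> v g2 = 1" and g2v: "\<phi> g2 v = 1"
        by (simp_all add: g2_def g1_def form_simps vg gv vH Hv True)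
      have vg1: "\<phi> v g1 = 1" and g1v: "\<phi> g1 v = 1"
        by (simp_all add: g1_def form_simps vg gv vH Hv)
      have "\<phi> g2 g2 = \<phi> g1 g1 + \<beta> ^ q + \<beta>"
        by (simp add: g2_def form_simps vg1 g1v True)
      then have g2g2: "\<phi> g2 g2 = 1" using \<beta> by (simp add: algebra_simps)
      have b1v: "\<phi> (b1 i) v = 0" and vb1: "\<phi> v (b1 i) = 0" if "i < M" for i
        using that by (simp_all add: b1_def form_simps bv vb True)
      have b1b1: "\<phi> (b1 i) (b1 j) = (if i = j then 1 else 0)" if "i < M" "j < M" for i j
        using that by (simp add: b1_def form_simps bv vb True b(2))
      have b1g2: "\<phi> (b1 i) g2 = 0" if "i < M" for i
      proof -
        have "\<phi> (b1 i) g2 = \<phi> (b i) g2 + a i" by (simp add: b1_def form_simps vg2)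
        also have "\<phi> (b i) g2 = \<phi> (b i) g + h i ^ q"
          using that by (simp add: g2_def g1_def form_simps bv bH)
        finally show ?thesis by (simp add: a_def)
      qed
      have g2b1: "\<phi> g2 (b1 i) = 0" if "i < M" for i
      proof -
        have "\<phi> g2 (b1 i) = \<phi> g2 (b i) + a i ^ q" by (simp add: b1_def form_simps g2v)
        also have "\<phi> g2 (b i) = \<phi> g (b i) + h i"
          using that by (simp add: g2_def g1_def form_simps vb Hb)
        also have "a i ^ q = - (\<phi> (b i) g ^ q) - h i ^ (q * q)"
          by (simp add: a_def frob_diff frob_minus power_mult)
        finally show ?thesis using h[of i] by (simp add: algebra_simps)
      qed
      define b' where "b' i = (if i < M then b1 i else if i = M then g2 else v2)" for i
      have g2V: "g2 \<in> V"
        using g HV v by (simp add: g2_def g1_def subspace_add[OF sV] subspace_scale[OF sV])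
      have b'V: "b' i \<in> V" for i
        using g2V v bV by (auto simp: b'_def b1_def v2_def intro!: subspace_add[OF sV] subspace_scale[OF sV] subspace_diff[OF sV])
      let ?S = "b' ` {..<N}"
      have b'S: "b' i \<in> span ?S" if "i < N" for i using that by (intro span_base) auto
      have g2S: "g2 \<in> span ?S" using b'S[of M] N by (simp add: b'_def)
      have v2S: "v2 \<in> span ?S" using b'S[of "Suc M"] N by (simp add: b'_def)
      have vS: "v \<in> span ?S"
      proof -
        have "inverse l *s v2 + g2 \<in> span ?S" using v2S g2S by (intro span_add span_scale)
        then show ?thesis using \<open>l \<noteq> 0\<close> by (simp add: v2_def)
      qed
      have CS: "C \<subseteq> span ?S"
        unfolding b(1)[symmetric]
      proof (rule shifted_basis_span[OF vS])
        show "b i + a i *s v \<in> span ?S" if "i < M" for i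
          using b'S[of i] that N by (simp add: b'_def b1_def)
      qed
      have "H \<in> C" unfolding H_def using bC by (intro subspace_sum[OF sC] subspace_scale[OF sC]) auto
      then have "g2 - \<beta> *s v - H \<in> span ?S" using CS g2S vS by (intro span_diff span_scale) auto
      then have gS: "g \<in> span ?S" by (simp add: g2_def g1_def)
      have "?U \<subseteq> span ?S" by (rule subset_span_complement[OF compC CS vS])
      then have "V \<subseteq> span ?S" using subset_span_complement[of V g ?U ?S] compU gS by auto
      moreover have "span ?S \<subseteq> V" using b'V by (intro span_minimal sV) auto
      ultimately have "span ?S = V" by (rule subset_antisym[rotated])
      moreover have "\<phi> (b' i) (b' j) = (if i = j then 1 else 0)" if "i < N" "j < N" for i j
      proof -
        have g2v2: "\<phi> g2 v2 = 0" and v2g2: "\<phi> v2 g2 = 0"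
          by (simp_all add: v2_def form_simps g2v vg2 g2g2)
        have "\<phi> v2 v2 = - (l ^ Suc q)" by (simp add: v2_def form_simps g2v vg2 g2g2 True)
        then have v2v2: "\<phi> v2 v2 = 1" using l by simp
        have b1v2: "\<phi> (b1 i) v2 = 0" and v2b1: "\<phi> v2 (b1 i) = 0" if "i < M" for i
          using that by (simp_all add: v2_def form_simps b1v vb1 b1g2 g2b1)
        show ?thesis
          using that N by (auto simp: b'_def g2v2 v2g2 v2v2 b1v2 v2b1 b1b1 b1g2 g2b1 g2g2)
      qed
      ultimately show ?thesis by blast
    qed
  qed
qed

end

section \<open>Forms whose right radical has dimension at most one\<close>

text \<open>
  The entries of \<open>W_s\<close>, written so that the size of the matrix does not enter: a normal basis of a
  subspace stays one when vectors are appended.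
\<close>

definition normal_entry :: "nat \<Rightarrow> nat \<Rightarrow> nat \<Rightarrow> 'k::zero_neq_one" where
  "normal_entry s i j =
     (if i < s \<or> j < s then (if i = j then 1 else 0) else (if i = Suc j then 1 else 0))"

context frobenius_form
begin

text \<open>
  Induction on the dimension in steps of two, along the chain of the nilpotent block from its end.
  If v spans the radical and \<open>\<phi> v\<close> does not vanish, then v is the last vector of the block and the
  vector before it is some g with \<open>\<phi> v g = 1\<close>, outside the kernel U of \<open>\<phi> v\<close>.  The form on a
  complement C of v in U has a radical of dimension at most one, because \<open>\<phi> g\<close> is
  injective on that radical.  A normal basis b of C is extended as follows.  Adding multiples of v to \<open>b i\<close> and to g
  changes only the products that have g on the right and are to be made zero.  Adding a vector H of C
  to g makes \<open>\<phi> g\<close> zero on all \<open>b j\<close> except the last vector of the block of C; there the value is not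
  zero, because this vector is not in the radical of V, and it becomes 1 after rescaling g.  Rescaling
  v as well keeps \<open>\<phi> v g = 1\<close>.
\<close>

lemma normal_basis_exists:
  assumes "has_dim V N" "\<exists>y0. \<forall>y\<in>V. (\<forall>x\<in>V. \<phi> x y = 0) \<longrightarrow> (\<exists>c. y = c *s y0)"
  shows "\<exists>s\<le>N. \<exists>b. span (b ` {..<N}) = V \<and> (\<forall>i<N. \<forall>j<N. \<phi> (b i) (b j) = normal_entry s i j)"
  using assms
proof (induction N arbitrary: V rule: less_induct)
  case (less N)
  note V = less.prems(1)
  have sV: "subspace V" by (rule has_dim_subspace[OF V])
  show ?case
  proof (cases "nondegenerate_on V")
    case True
    then obtain b where "span (b ` {..<N}) = V"
      "\<And>i j. i < N \<Longrightarrow> j < N \<Longrightarrow> \<phi> (b i) (b j) = (if i = j then 1 else 0)"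
      using orthonormal_basis_exists[OF V] by blast
    then show ?thesis by (intro exI[of _ N] conjI exI[of _ b]) (simp_all add: normal_entry_def)
  next
    case False
    then obtain v where v: "v \<in> V" "v \<noteq> 0" and xv: "\<And>x. x \<in> V \<Longrightarrow> \<phi> x v = 0"
      unfolding nondegenerate_on_def by blast
    have rad: "\<exists>c. y = c *s v" if y: "y \<in> V" "\<And>x. x \<in> V \<Longrightarrow> \<phi> x y = 0" for y
    proof -
      obtain y0 where y0: "\<And>y. y \<in> V \<Longrightarrow> (\<forall>x\<in>V. \<phi> x y = 0) \<Longrightarrow> \<exists>c. y = c *s y0"
        using less.prems(2) by blast
      obtain c d where c: "v = c *s y0" and d: "y = d *s y0" using y0[OF v(1)] y0[OF y(1)] xv y(2) by blast
      have "c \<noteq> 0" using c v by auto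
      then have "y = (d / c) *s v" by (simp add: c d)
      then show ?thesis ..
    qed
    show ?thesis
    proof (cases "\<forall>x\<in>V. \<phi> v x = 0")
      case True
      obtain C where C: "has_dim C (N - 1)" "C \<subseteq> V" "v \<notin> C" "N > 0"
        and comp: "\<And>x. x \<in> V \<Longrightarrow> \<exists>k. x - k *s v \<in> C"
        using complement_of_vector[OF V v] by blast
      have sC: "subspace C" by (rule has_dim_subspace[OF C(1)])
      have "nondegenerate_on C"
        unfolding nondegenerate_on_def
      proof (intro ballI impI)
        fix y assume y: "y \<in> C" "\<forall>x\<in>C. \<phi> x y = 0"
        have yV: "y \<in> V" using y(1) C(2) by auto
        have "\<phi> x y = 0" if x: "x \<in> V" for x
        proof -
          obtain k where "x - k *s v \<in> C" using comp[OF x] by blast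
          then have "\<phi> (x - k *s v) y = 0" using y(2) by blast
          then show ?thesis using True yV by (simp add: form_simps)
        qed
        then obtain c where c: "y = c *s v" using rad[OF yV] by blast
        show "y = 0"
        proof (cases "c = 0")
          case False
          have "inverse c *s y \<in> C" using y(1) by (rule subspace_scale[OF sC])
          then show ?thesis using C(3) False by (simp add: c)
        qed (simp add: c)
      qed
      then obtain b where b: "span (b ` {..<N - 1}) = C"
        "\<And>i j. i < N - 1 \<Longrightarrow> j < N - 1 \<Longrightarrow> \<phi> (b i) (b j) = (if i = j then 1 else 0)"
        using orthonormal_basis_exists[OF C(1)] by blast
      define b' where "b' = b(N - 1 := v)"
      have bV: "b i \<in> V" if "i < N - 1" for i
        using that b(1) C(2) span_base[of "b i" "b ` {..<N - 1}"] by auto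
      have im: "b' ` {..<N} = insert v (b ` {..<N - 1})"
        using \<open>N > 0\<close> by (auto simp: b'_def image_iff)
      have "span (b' ` {..<N}) = V"
      proof
        show "span (b' ` {..<N}) \<subseteq> V"
          unfolding im using bV v by (intro span_minimal sV) auto
        have "C \<subseteq> span (b' ` {..<N})" unfolding b(1)[symmetric] im by (rule span_mono) auto
        moreover have "v \<in> span (b' ` {..<N})" unfolding im by (rule span_base) simp
        ultimately show "V \<subseteq> span (b' ` {..<N})" using subset_span_complement[of V v C] comp by auto
      qed
      moreover have "\<phi> (b' i) (b' j) = normal_entry (N - 1) i j" if "i < N" "j < N" for i j
        using that b(2)[of i j] bV[of i] bV[of j] xv True v by (auto simp: b'_def normal_entry_def)
      ultimately show ?thesis by (intro exI[of _ "N - 1"] conjI exI[of _ b']) auto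
    next
      case False
      then obtain x where x: "x \<in> V" "\<phi> v x \<noteq> 0" by auto
      obtain r where r: "r ^ q = inverse (\<phi> v x)" using frob_root by auto
      define g where "g = r *s x"
      have g: "g \<in> V" using x by (simp add: g_def subspace_scale[OF sV])
      have vg: "\<phi> v g = 1" using x(2) by (simp add: g_def form_simps r)
      let ?U = "{x \<in> V. \<phi> v x = 0}"
      have U: "has_dim ?U (N - 1)"
        using kernel_has_dim(1)[OF V frob_linear_form g] vg by simp
      have compU: "\<exists>k. x - k *s g \<in> ?U" if "x \<in> V" for x
        using kernel_complement[OF frob_linear_form sV g _ that] vg by simp
      have vU: "v \<in> ?U" using v xv by simp
      obtain C where C: "has_dim C (N - 1 - 1)" "C \<subseteq> ?U" "v \<notin> C" "N - 1 > 0"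
        and compC: "\<And>x. x \<in> ?U \<Longrightarrow> \<exists>k. x - k *s v \<in> C"
        using complement_of_vector[OF U vU v(2)] by blast
      define M where "M = N - 2"
      have N: "N = Suc (Suc M)" using C(4) by (simp add: M_def)
      have sC: "subspace C" by (rule has_dim_subspace[OF C(1)])
      have radC: "y = 0" if y: "y \<in> C" "\<forall>x\<in>C. \<phi> x y = 0" "\<phi> g y = 0" for y
      proof -
        have yV: "y \<in> V" "\<phi> v y = 0" using y(1) C(2) by auto
        have "\<phi> x y = 0" if x: "x \<in> V" for x
        proof -
          obtain k where k: "x - k *s g \<in> ?U" using compU[OF x] by blast
          obtain m where m: "x - k *s g - m *s v \<in> C" using compC[OF k] by blast
          then have "\<phi> (x - k *s g - m *s v) y = 0" using y(2) by blast
          then show ?thesis using yV y(3) by (simp add: form_simps)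
        qed
        then obtain c where c: "y = c *s v" using rad[OF yV(1)] by blast
        show "y = 0"
        proof (cases "c = 0")
          case False
          have "inverse c *s y \<in> C" using y(1) by (rule subspace_scale[OF sC])
          then show ?thesis using C(3) False by (simp add: c)
        qed (simp add: c)
      qed
      have "\<exists>y0. \<forall>y\<in>C. (\<forall>x\<in>C. \<phi> x y = 0) \<longrightarrow> (\<exists>c. y = c *s y0)"
      proof (cases "\<exists>y0\<in>C. (\<forall>x\<in>C. \<phi> x y0 = 0) \<and> \<phi> g y0 \<noteq> 0")
        case False
        then show ?thesis using radC by (intro exI[of _ 0]) auto
      next
        case True
        then obtain y0 where y0: "y0 \<in> C" "\<forall>x\<in>C. \<phi> x y0 = 0" "\<phi> g y0 \<noteq> 0" by blast
        have "\<exists>c. y = c *s y0" if y: "y \<in> C" "\<forall>x\<in>C. \<phi> x y = 0" for y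
        proof -
          obtain t where t: "t ^ q = \<phi> g y / \<phi> g y0" using frob_root by auto
          have "y - t *s y0 = 0"
            using y y0 t by (intro radC) (auto simp: form_simps intro!: subspace_diff[OF sC] subspace_scale[OF sC])
          then have "y = t *s y0" by simp
          then show ?thesis ..
        qed
        then show ?thesis by blast
      qed
      moreover have "M < N" "has_dim C M" using C(1) N by auto
      ultimately obtain s b where s: "s \<le> M" and b: "span (b ` {..<M}) = C"
        "\<And>i j. i < M \<Longrightarrow> j < M \<Longrightarrow> \<phi> (b i) (b j) = normal_entry s i j"
        using less.IH[of M C] by auto
      have bC: "b i \<in> C" if "i < M" for i
        using that b(1) span_base[of "b i" "b ` {..<M}"] by auto
      have bV: "b i \<in> V" and vb: "\<phi> v (b i) = 0" and bv: "\<phi> (b i) v = 0" if "i < M" for i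
        using bC[OF that] C(2) xv by auto
      have vv: "\<phi> v v = 0" and gv: "\<phi> g v = 0" using xv v g by auto
      \<comment> \<open>The row of \<open>\<phi> H\<close> in the basis b has the entries \<open>h j\<close> for \<open>j < s\<close>, and it is shifted by one from
        there on; \<open>h s\<close> is arbitrary, as \<open>\<phi> (b s)\<close> is zero on C.\<close>
      define h where "h i = (if i < s then - \<phi> g (b i) else if i = s then 0 else - \<phi> g (b (i - 1)))" for i
      define H where "H = (\<Sum>i<M. h i *s b i)"
      define g1 where "g1 = g + H"
      have HC: "H \<in> C" unfolding H_def using bC by (intro subspace_sum[OF sC] subspace_scale[OF sC]) auto
      have HV: "H \<in> V" and vH: "\<phi> v H = 0" using HC C(2) by auto
      have g1V: "g1 \<in> V" using g HV by (simp add: g1_def subspace_add[OF sV])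
      have vg1: "\<phi> v g1 = 1" by (simp add: g1_def form_simps vg vH)
      have Hb: "\<phi> H (b j) = - \<phi> g (b j)" if "j < M" "j < s \<or> Suc j < M" for j
      proof -
        have "\<phi> H (b j) = (\<Sum>i<M. if i = (if j < s then j else Suc j) then h i else 0)"
          unfolding H_def sum_left using that(1) by (intro sum.cong) (auto simp: b(2) normal_entry_def)
        also have "\<dots> = h (if j < s then j else Suc j)" using that by (subst sum.delta) auto
        finally show ?thesis by (simp add: h_def)
      qed
      have Hlast: "\<phi> H (b j) = 0" if "s \<le> j" "Suc j = M" for j
        unfolding H_def sum_left using that by (intro sum.neutral) (auto simp: b(2) normal_entry_def)
      have g1b: "\<phi> g1 (b j) = 0" if "j < M" "j < s \<or> Suc j < M" for j
        using Hb[OF that] by (simp add: g1_def form_simps)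
      have last_nz: "\<phi> g1 (b j) \<noteq> 0" if j: "s \<le> j" "Suc j = M" for j
      proof
        assume *: "\<phi> g1 (b j) = 0"
        have jM: "j < M" using j by simp
        have "\<phi> x (b j) = 0" if x: "x \<in> C" for x
        proof -
          obtain a where "x = (\<Sum>i<M. a i *s b i)" using x b(1) in_span_image_lessThan[of x b M] by auto
          then show ?thesis using j by (auto simp: sum_left b(2) normal_entry_def intro!: sum.neutral)
        qed
        moreover have "\<phi> g (b j) = 0" using * Hlast[OF j] by (simp add: g1_def form_simps)
        ultimately have "b j = 0" using radC[OF bC[OF jM]] by blast
        have "C \<subseteq> span (b ` {..<j})"
        proof -
          have "b ` {..<M} = insert 0 (b ` {..<j})"
            unfolding j(2)[symmetric] lessThan_Suc by (simp add: \<open>b j = 0\<close>)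
          then show ?thesis using b(1) by simp
        qed
        moreover have "b ` {..<j} \<subseteq> C" using bC j by auto
        moreover have "card (b ` {..<j}) \<le> j" using card_image_le[of "{..<j}" b] by simp
        ultimately have "card (b ` {..<j}) = M"
          using has_dim_spanning(2)[OF \<open>has_dim C M\<close>, of "b ` {..<j}"] j by simp
        then show False using \<open>card (b ` {..<j}) \<le> j\<close> j by simp
      qed
      \<comment> \<open>If \<open>s = M\<close>, then C has no nilpotent block, and no rescaling is required.\<close>
      obtain l where l: "l \<noteq> 0" "\<And>j. s \<le> j \<Longrightarrow> Suc j = M \<Longrightarrow> l * \<phi> g1 (b j) = 1"
      proof (cases "s < M")
        case True
        then show ?thesis using that[of "inverse (\<phi> g1 (b (M - 1)))"] last_nz[of "M - 1"] by force
      next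
        case False
        then show ?thesis using that[of 1] by auto
      qed
      define g2 where "g2 = l *s g1"
      have g2V: "g2 \<in> V" using g1V by (simp add: g2_def subspace_scale[OF sV])
      define v' where "v' = inverse (l ^ q) *s v"
      have v'V: "v' \<in> V" using v by (simp add: v'_def subspace_scale[OF sV])
      have v'g2: "\<phi> v' g2 = 1" using l(1) by (simp add: v'_def g2_def form_simps vg1)
      have xv': "\<phi> x v' = 0" if "x \<in> V" for x using xv[OF that] by (simp add: v'_def form_simps)
      have v'b: "\<phi> v' (b i) = 0" if "i < M" for i using vb[OF that] by (simp add: v'_def form_simps)
      have v'v': "\<phi> v' v' = 0" by (rule xv'[OF v'V])
      define a where "a i = - \<phi> (b i) g2" for i
      define b1 where "b1 i = b i + a i *s v'" for i
      define g3 where "g3 = g2 - \<phi> g2 g2 *s v'"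
      have b1V: "b1 i \<in> V" if "i < M" for i
        using bV[OF that] v'V by (simp add: b1_def subspace_add[OF sV] subspace_scale[OF sV])
      have g3V: "g3 \<in> V" using g2V v'V by (simp add: g3_def subspace_diff[OF sV] subspace_scale[OF sV])
      have b1b1: "\<phi> (b1 i) (b1 j) = normal_entry s i j" if "i < M" "j < M" for i j
        using that by (simp add: b1_def form_simps xv'[OF bV] v'b v'v' b(2))
      have b1g3: "\<phi> (b1 i) g3 = 0" if "i < M" for i
        using that by (simp add: b1_def g3_def a_def form_simps xv'[OF bV] v'g2 v'v')
      have g3g3: "\<phi> g3 g3 = 0"
        by (simp add: g3_def form_simps xv'[OF g2V] v'g2 v'v')
      have g3b1: "\<phi> g3 (b1 j) = normal_entry s M j" if j: "j < M" for j
      proof -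
        have "\<phi> g3 (b1 j) = l * \<phi> g1 (b j)"
          using j by (simp add: b1_def g3_def form_simps xv'[OF g2V] v'b v'v') (simp add: g2_def form_simps)
        also have "\<dots> = normal_entry s M j"
        proof (cases "j < s \<or> Suc j < M")
          case True
          then show ?thesis using g1b[OF j True] s j by (auto simp: normal_entry_def)
        next
          case False
          then have "s \<le> j" "Suc j = M" using j by auto
          then show ?thesis using l(2) s by (simp add: normal_entry_def)
        qed
        finally show ?thesis .
      qed
      define b' where "b' i = (if i < M then b1 i else if i = M then g3 else v')" for i
      have b'V: "b' i \<in> V" for i using b1V g3V v'V by (simp add: b'_def)
      let ?S = "b' ` {..<N}"
      have b'S: "b' i \<in> span ?S" if "i < N" for i using that by (intro span_base) auto
      have g3S: "g3 \<in> span ?S" using b'S[of M] N by (simp add: b'_def)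
      have v'S: "v' \<in> span ?S" using b'S[of "Suc M"] N by (simp add: b'_def)
      have "l ^ q *s v' \<in> span ?S" using v'S by (rule span_scale)
      then have vS: "v \<in> span ?S" using l(1) by (simp add: v'_def)
      have CS: "C \<subseteq> span ?S"
        unfolding b(1)[symmetric]
      proof (rule shifted_basis_span[OF v'S])
        show "b i + a i *s v' \<in> span ?S" if "i < M" for i
          using b'S[of i] that N by (simp add: b'_def b1_def)
      qed
      have "g3 + \<phi> g2 g2 *s v' \<in> span ?S" using g3S v'S by (intro span_add span_scale)
      then have "inverse l *s g2 \<in> span ?S" by (intro span_scale) (simp add: g3_def)
      then have "g1 \<in> span ?S" using l(1) by (simp add: g2_def)
      then have "g1 - H \<in> span ?S" using CS HC by (intro span_diff) auto
      then have gS: "g \<in> span ?S" by (simp add: g1_def)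
      have "?U \<subseteq> span ?S" by (rule subset_span_complement[OF compC CS vS])
      then have "V \<subseteq> span ?S" using subset_span_complement[of V g ?U ?S] compU gS by auto
      moreover have "span ?S \<subseteq> V" using b'V by (intro span_minimal sV) auto
      ultimately have "span ?S = V" by (rule subset_antisym[rotated])
      moreover have "\<phi> (b' i) (b' j) = normal_entry s i j" if ij: "i < N" "j < N" for i j
      proof -
        consider "i < M" | "i = M" | "i = Suc M" using ij N by linarith
        then show ?thesis
        proof cases
          case 1
          then show ?thesis using ij N s b1b1[of i j] b1g3[OF 1] xv'[OF b1V[OF 1]]
            by (auto simp: b'_def normal_entry_def)
        next
          case 2
          then show ?thesis using ij N s g3b1[of j] g3g3 xv'[OF g3V]
            by (auto simp: b'_def normal_entry_def)
        next
          case 3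
          have "\<phi> v' (b1 j) = 0" if "j < M" using that by (simp add: b1_def form_simps v'b v'v')
          moreover have "\<phi> v' g3 = 1" by (simp add: g3_def form_simps v'g2 v'v')
          ultimately show ?thesis using 3 ij N s v'v'
            by (auto simp: b'_def normal_entry_def)
        qed
      qed
      ultimately show ?thesis using s N by (intro exI[of _ s] conjI exI[of _ b']) auto
    qed
  qed
qed

end

section \<open>Substitution in polynomials\<close>

lemma sum_singles: "(\<Sum>m\<in>Poly_Mapping.keys F. Poly_Mapping.single m (Poly_Mapping.lookup F m)) = F"
proof (rule poly_mapping_eqI)
  fix k
  have "Poly_Mapping.lookup (\<Sum>m\<in>Poly_Mapping.keys F. Poly_Mapping.single m (Poly_Mapping.lookup F m)) k
      = (\<Sum>m\<in>Poly_Mapping.keys F. if m = k then Poly_Mapping.lookup F m else 0)"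
    unfolding lookup_sum by (intro sum.cong) (auto simp: lookup_single when_def)
  also have "\<dots> = Poly_Mapping.lookup F k" by (simp add: in_keys_iff)
  finally show "Poly_Mapping.lookup (\<Sum>m\<in>Poly_Mapping.keys F. Poly_Mapping.single m (Poly_Mapping.lookup F m)) k
      = Poly_Mapping.lookup F k" .
qed

lemma Const_0 [simp]: "Const 0 = 0" by (simp add: Const_def)
lemma Const_1 [simp]: "Const 1 = 1" by (simp add: Const_def)
lemma Const_add: "Const (a + b) = Const a + Const b" by (simp add: Const_def single_add)
lemma Const_mult: "Const (a * b) = Const a * Const b" by (simp add: Const_def mult_single)
lemma Const_power: "Const (a ^ k) = Const a ^ k" by (induction k) (simp_all add: Const_mult)
lemma Const_sum: "Const (\<Sum>i\<in>I. f i) = (\<Sum>i\<in>I. Const (f i))"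
  by (induction I rule: infinite_finite_induct) (simp_all add: Const_add)

lemma lookup_Const_mult: "Poly_Mapping.lookup (Const c * F) m = c * Poly_Mapping.lookup F m"
  by (simp add: Const_def mult_map_scale_conv_mult[symmetric] Poly_Mapping.map.rep_eq when_def)

lemma Var_power: "Var i ^ k = Poly_Mapping.single (Poly_Mapping.single i k) 1"
  by (induction k) (simp_all add: Var_def mult_single single_add[symmetric])

definition subst_monom :: "(nat \<Rightarrow> 'k::comm_semiring_1 mpoly) \<Rightarrow> (nat \<Rightarrow>\<^sub>0 nat) \<Rightarrow> 'k mpoly" where
  "subst_monom \<sigma> m = (\<Prod>i\<in>Poly_Mapping.keys m. \<sigma> i ^ Poly_Mapping.lookup m i)"

lemma subst_monom_superset:
  assumes "finite S" "Poly_Mapping.keys m \<subseteq> S"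
  shows "subst_monom \<sigma> m = (\<Prod>i\<in>S. \<sigma> i ^ Poly_Mapping.lookup m i)"
  unfolding subst_monom_def using assms
  by (intro prod.mono_neutral_left) (auto simp: in_keys_iff)

lemma subst_monom_add: "subst_monom \<sigma> (a + b) = subst_monom \<sigma> a * subst_monom \<sigma> b"
proof -
  let ?S = "Poly_Mapping.keys a \<union> Poly_Mapping.keys b"
  have "Poly_Mapping.keys (a + b) \<subseteq> ?S" by (rule keys_add)
  then show ?thesis
    by (simp add: subst_monom_superset[of ?S] lookup_add power_add prod.distrib)
qed

lemma subst_monom_0 [simp]: "subst_monom \<sigma> 0 = 1"
  by (simp add: subst_monom_def)

lemma subst_monom_single: "subst_monom \<sigma> (Poly_Mapping.single i k) = \<sigma> i ^ k"
  by (simp add: subst_monom_superset[of "{i}"])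

lemma subst_mpoly_superset:
  assumes "finite S" "Poly_Mapping.keys F \<subseteq> S"
  shows "subst_mpoly \<sigma> F = (\<Sum>m\<in>S. Const (Poly_Mapping.lookup F m) * subst_monom \<sigma> m)"
  unfolding subst_mpoly_def subst_monom_def using assms
  by (intro sum.mono_neutral_left) (auto simp: in_keys_iff)

lemma subst_0 [simp]: "subst_mpoly \<sigma> 0 = 0"
  by (simp add: subst_mpoly_def)

lemma subst_add: "subst_mpoly \<sigma> (F + G) = subst_mpoly \<sigma> F + subst_mpoly \<sigma> G"
proof -
  let ?S = "Poly_Mapping.keys F \<union> Poly_Mapping.keys G"
  have "Poly_Mapping.keys (F + G) \<subseteq> ?S" by (rule keys_add)
  then show ?thesis
    by (simp add: subst_mpoly_superset[of ?S] lookup_add Const_add distrib_right sum.distrib)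
qed

lemma subst_sum: "subst_mpoly \<sigma> (\<Sum>i\<in>I. F i) = (\<Sum>i\<in>I. subst_mpoly \<sigma> (F i))"
  by (induction I rule: infinite_finite_induct) (simp_all add: subst_add)

lemma subst_single: "subst_mpoly \<sigma> (Poly_Mapping.single m c) = Const c * subst_monom \<sigma> m"
  by (simp add: subst_mpoly_superset[of "{m}"])

lemma subst_Const [simp]: "subst_mpoly \<sigma> (Const c) = Const c"
  by (simp add: Const_def subst_single)

lemma subst_1 [simp]: "subst_mpoly \<sigma> 1 = 1"
  using subst_Const[of \<sigma> 1] by simp

lemma subst_Var [simp]: "subst_mpoly \<sigma> (Var i) = \<sigma> i"
  by (simp add: Var_def subst_single subst_monom_single)

lemma mpoly_induct [case_names single sum]:
  fixes F :: "'k::comm_semiring_1 mpoly"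
  assumes "\<And>m c. P (Poly_Mapping.single m c)" "\<And>F G. P F \<Longrightarrow> P G \<Longrightarrow> P (F + G)"
  shows "P F"
proof -
  have "P 0" using assms(1)[of 0 0] by simp
  have "P (\<Sum>m\<in>K. Poly_Mapping.single m (Poly_Mapping.lookup F m))" for K
    by (induction K rule: infinite_finite_induct) (simp_all add: assms \<open>P 0\<close>)
  then show ?thesis using sum_singles[of F] by metis
qed

lemma subst_mult: "subst_mpoly \<sigma> (F * G) = subst_mpoly \<sigma> F * subst_mpoly \<sigma> G"
proof (induction F rule: mpoly_induct)
  case (single m c)
  show ?case
  proof (induction G rule: mpoly_induct)
    case (single m' c')
    then show ?case
      by (simp add: mult_single subst_single subst_monom_add Const_mult algebra_simps)
  qed (simp add: distrib_left subst_add)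
qed (simp add: distrib_right subst_add)

lemma subst_power: "subst_mpoly \<sigma> (F ^ k) = subst_mpoly \<sigma> F ^ k"
  by (induction k) (simp_all add: subst_mult)

lemma subst_prod: "subst_mpoly \<sigma> (\<Prod>i\<in>I. F i) = (\<Prod>i\<in>I. subst_mpoly \<sigma> (F i))"
  by (induction I rule: infinite_finite_induct) (simp_all add: subst_mult)

lemma subst_subst: "subst_mpoly \<sigma> (subst_mpoly \<tau> F) = subst_mpoly (\<lambda>i. subst_mpoly \<sigma> (\<tau> i)) F"
  by (induction F rule: mpoly_induct)
    (simp_all add: subst_add subst_single subst_mult subst_monom_def subst_prod subst_power)

section \<open>Linear changes of coordinates\<close>

lemma subst_monom_Var: "subst_monom Var m = Poly_Mapping.single m 1"
proof -
  have *: "(\<Prod>i\<in>K. Poly_Mapping.single (Poly_Mapping.single i (Poly_Mapping.lookup m i)) 1)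
      = Poly_Mapping.single (\<Sum>i\<in>K. Poly_Mapping.single i (Poly_Mapping.lookup m i)) 1" for K
    by (induction K rule: infinite_finite_induct) (simp_all add: mult_single)
  show ?thesis unfolding subst_monom_def Var_power * sum_singles ..
qed

lemma subst_Var_ident: "subst_mpoly Var F = F"
  by (induction F rule: mpoly_induct)
    (simp_all add: subst_add subst_single subst_monom_Var Const_def mult_single)

lemma coord_ring_exponent:
  "F \<in> coord_ring n \<Longrightarrow> m \<in> Poly_Mapping.keys F \<Longrightarrow> i \<in> Poly_Mapping.keys m \<Longrightarrow> i \<le> n"
  by (auto simp: coord_ring_def)

lemma subst_cong_coord_ring:
  assumes "F \<in> coord_ring n" "\<And>i. i \<le> n \<Longrightarrow> \<sigma> i = \<tau> i"
  shows "subst_mpoly \<sigma> F = subst_mpoly \<tau> F"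
  unfolding subst_mpoly_def using assms
  by (intro sum.cong refl arg_cong2[of _ _ _ _ "(*)"] prod.cong) (auto dest: coord_ring_exponent)

lemma coord_ring_Const: "Const c \<in> coord_ring n"
  by (auto simp: coord_ring_def Const_def)

lemma coord_ring_Var: "i \<le> n \<Longrightarrow> Var i \<in> coord_ring n"
  by (auto simp: coord_ring_def Var_def)

lemma coord_ring_add: "F \<in> coord_ring n \<Longrightarrow> G \<in> coord_ring n \<Longrightarrow> F + G \<in> coord_ring n"
  using keys_add[of F G] by (auto simp: coord_ring_def)

lemma coord_ring_mult:
  assumes "F \<in> coord_ring n" "G \<in> coord_ring n" shows "F * G \<in> coord_ring n"
proof -
  have "Poly_Mapping.keys m \<subseteq> {..n}" if m: "m \<in> Poly_Mapping.keys (F * G)" for m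
  proof -
    obtain a b where "m = a + b" "a \<in> Poly_Mapping.keys F" "b \<in> Poly_Mapping.keys G"
      using keys_mult[of F G] m by auto
    then show ?thesis using assms keys_add[of a b] by (auto dest: coord_ring_exponent)
  qed
  then show ?thesis by (simp add: coord_ring_def)
qed

lemma coord_ring_sum: "(\<And>i. i \<in> I \<Longrightarrow> F i \<in> coord_ring n) \<Longrightarrow> (\<Sum>i\<in>I. F i) \<in> coord_ring n"
  using coord_ring_Const[of 0 n]
  by (induction I rule: infinite_finite_induct) (auto intro: coord_ring_add)

lemma coord_ring_prod: "(\<And>i. i \<in> I \<Longrightarrow> F i \<in> coord_ring n) \<Longrightarrow> (\<Prod>i\<in>I. F i) \<in> coord_ring n"
  using coord_ring_Const[of 1 n]
  by (induction I rule: infinite_finite_induct) (auto intro: coord_ring_mult)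

lemma coord_ring_power: "F \<in> coord_ring n \<Longrightarrow> F ^ k \<in> coord_ring n"
  using coord_ring_Const[of 1 n] by (induction k) (auto intro: coord_ring_mult)

lemma coord_ring_subst:
  assumes "F \<in> coord_ring n" "\<And>i. i \<le> n \<Longrightarrow> \<sigma> i \<in> coord_ring n"
  shows "subst_mpoly \<sigma> F \<in> coord_ring n"
  unfolding subst_mpoly_def using assms
  by (intro coord_ring_sum coord_ring_mult coord_ring_Const coord_ring_prod coord_ring_power)
    (auto dest: coord_ring_exponent)

lemma coord_ring_lin_pullback: "F \<in> coord_ring n \<Longrightarrow> lin_pullback n T F \<in> coord_ring n"
  unfolding lin_pullback_def
  by (intro coord_ring_subst coord_ring_sum coord_ring_mult coord_ring_Const coord_ring_Var) auto

lemma lin_pullback_mult: "lin_pullback n T (F * G) = lin_pullback n T F * lin_pullback n T G"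
  by (simp add: lin_pullback_def subst_mult)

lemma lin_pullback_comp:
  assumes "S \<in> carrier_mat (n + 1) (n + 1)" "T \<in> carrier_mat (n + 1) (n + 1)" "F \<in> coord_ring n"
  shows "lin_pullback n T (lin_pullback n S F) = lin_pullback n (S * T) F"
  unfolding lin_pullback_def subst_subst
proof (rule subst_cong_coord_ring[OF assms(3)])
  fix i assume i: "i \<le> n"
  have "(\<Sum>j\<le>n. Const ((S * T) $$ (i, j)) * Var j)
      = (\<Sum>j\<le>n. \<Sum>k\<le>n. Const (S $$ (i, k)) * Const (T $$ (k, j)) * Var j)"
  proof (rule sum.cong[OF refl])
    fix j assume "j \<in> {..n}"
    then have "(S * T) $$ (i, j) = (\<Sum>k\<le>n. S $$ (i, k) * T $$ (k, j))"
      using assms i by (simp add: scalar_prod_def atLeast0LessThan lessThan_Suc_atMost)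
    then show "Const ((S * T) $$ (i, j)) * Var j = (\<Sum>k\<le>n. Const (S $$ (i, k)) * Const (T $$ (k, j)) * Var j)"
      by (simp add: Const_sum Const_mult sum_distrib_right)
  qed
  also have "\<dots> = (\<Sum>k\<le>n. Const (S $$ (i, k)) * (\<Sum>j\<le>n. Const (T $$ (k, j)) * Var j))"
    by (subst sum.swap) (simp add: sum_distrib_left mult.assoc)
  finally show "subst_mpoly (\<lambda>i. \<Sum>j\<le>n. Const (T $$ (i, j)) * Var j) (\<Sum>j\<le>n. Const (S $$ (i, j)) * Var j)
      = (\<Sum>j\<le>n. Const ((S * T) $$ (i, j)) * Var j)"
    by (simp add: subst_sum subst_mult)
qed

lemma lin_pullback_one:
  assumes "F \<in> coord_ring n" shows "lin_pullback n (1\<^sub>m (n + 1)) F = F"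
proof -
  have "lin_pullback n (1\<^sub>m (n + 1)) F = subst_mpoly Var F"
    unfolding lin_pullback_def
  proof (rule subst_cong_coord_ring[OF assms])
    fix i assume i: "i \<le> n"
    have "(\<Sum>j\<le>n. Const ((1\<^sub>m (n + 1) :: 'a mat) $$ (i, j)) * Var j) = (\<Sum>j\<le>n. if i = j then Var j else 0)"
      using i by (intro sum.cong) auto
    then show "(\<Sum>j\<le>n. Const ((1\<^sub>m (n + 1) :: 'a mat) $$ (i, j)) * Var j) = Var i" using i by simp
  qed
  then show ?thesis by (simp add: subst_Var_ident)
qed

section \<open>Forms in the polynomial ring and their hypersurfaces\<close>

text \<open>
  The characteristic is needed in the polynomial ring itself, where the q-th power of a linear form is
  expanded.
\<close>

lemma CHAR_mpoly: "CHAR('k::comm_semiring_1 mpoly) = CHAR('k)"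
proof (rule CHAR_eqI)
  have eq: "(of_nat k :: 'k mpoly) = 0 \<longleftrightarrow> (of_nat k :: 'k) = 0" for k
    unfolding single_of_nat[symmetric] by (metis single_zero lookup_single_eq lookup_zero)
  show "(of_nat CHAR('k) :: 'k mpoly) = 0" by (simp only: eq of_nat_CHAR)
  show "CHAR('k) dvd k" if "(of_nat k :: 'k mpoly) = 0" for k
    using that by (simp only: eq of_nat_eq_0_iff_char_dvd)
qed

definition mat_form :: "nat \<Rightarrow> nat \<Rightarrow> 'k::comm_semiring_1 mat \<Rightarrow> (nat \<Rightarrow> 'k) \<Rightarrow> (nat \<Rightarrow> 'k) \<Rightarrow> 'k" where
  "mat_form q n A x y = (\<Sum>i\<le>n. \<Sum>j\<le>n. A $$ (i, j) * x i * y j ^ q)"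

text \<open>
  The matrix \<open>T\<^sup>t A T^(q)\<close>, described by the values of the form on the columns of T.
\<close>

definition pullback_mat :: "nat \<Rightarrow> nat \<Rightarrow> 'k::comm_semiring_1 mat \<Rightarrow> 'k mat \<Rightarrow> 'k mat" where
  "pullback_mat q n T A = mat (n + 1) (n + 1)
     (\<lambda>(k, l). mat_form q n A (\<lambda>i. T $$ (i, k)) (\<lambda>j. T $$ (j, l)))"

lemma lin_pullback_frob_form:
  fixes A :: "'k::comm_ring_1 mat"
  assumes "prime CHAR('k)" "q = CHAR('k) ^ e"
  shows "lin_pullback n T (frob_form q n A) = frob_form q n (pullback_mat q n T A)"
proof -
  have frob: "(\<Sum>l\<le>n. Const (T $$ (j, l)) * Var l) ^ q = (\<Sum>l\<le>n. Const (T $$ (j, l) ^ q) * Var l ^ q)" for j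
    using assms by (subst freshmans_dream_sum'[where n = e])
      (simp_all add: CHAR_mpoly power_mult_distrib Const_power)
  have "lin_pullback n T (frob_form q n A) =
    (\<Sum>i\<le>n. \<Sum>j\<le>n. \<Sum>k\<le>n. \<Sum>l\<le>n. Const (A $$ (i, j) * T $$ (i, k) * T $$ (j, l) ^ q) * Var k * Var l ^ q)"
    unfolding lin_pullback_def frob_form_def subst_sum subst_mult subst_power subst_Const subst_Var frob
    by (simp add: sum_product sum_distrib_left sum_distrib_right Const_mult algebra_simps)
  also have "\<dots> = (\<Sum>k\<le>n. \<Sum>l\<le>n. \<Sum>i\<le>n. \<Sum>j\<le>n. Const (A $$ (i, j) * T $$ (i, k) * T $$ (j, l) ^ q) * Var k * Var l ^ q)"
    (is "(\<Sum>i\<le>n. \<Sum>j\<le>n. \<Sum>k\<le>n. \<Sum>l\<le>n. ?f i j k l) = _")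
  proof -
    have "(\<Sum>i\<le>n. \<Sum>j\<le>n. \<Sum>k\<le>n. \<Sum>l\<le>n. ?f i j k l) = (\<Sum>i\<le>n. \<Sum>k\<le>n. \<Sum>j\<le>n. \<Sum>l\<le>n. ?f i j k l)"
      by (intro sum.cong refl sum.swap)
    also have "\<dots> = (\<Sum>k\<le>n. \<Sum>i\<le>n. \<Sum>j\<le>n. \<Sum>l\<le>n. ?f i j k l)" by (rule sum.swap)
    also have "\<dots> = (\<Sum>k\<le>n. \<Sum>i\<le>n. \<Sum>l\<le>n. \<Sum>j\<le>n. ?f i j k l)"
      by (intro sum.cong refl sum.swap)
    also have "\<dots> = (\<Sum>k\<le>n. \<Sum>l\<le>n. \<Sum>i\<le>n. \<Sum>j\<le>n. ?f i j k l)"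
      by (intro sum.cong refl sum.swap)
    finally show ?thesis .
  qed
  also have "\<dots> = frob_form q n (pullback_mat q n T A)"
    unfolding frob_form_def
    by (intro sum.cong refl) (simp add: pullback_mat_def mat_form_def Const_sum sum_distrib_right)
  finally show ?thesis .
qed

lemma frob_monomial:
  "Const a * Var i * Var j ^ q = Poly_Mapping.single (Poly_Mapping.single i 1 + Poly_Mapping.single j q) a"
  by (simp add: Const_def Var_power mult_single) (simp add: Var_def mult_single)

text \<open>
  Since \<open>q > 1\<close>, the variable occurring with exponent at least q can be recognised, so the
  coefficients of the form determine the matrix.
\<close>

lemma frob_exponent_inject:
  assumes "q > 1"
  shows "Poly_Mapping.single i (1::nat) + Poly_Mapping.single j q = Poly_Mapping.single k 1 + Poly_Mapping.single l q
    \<longleftrightarrow> i = k \<and> j = l" (is "?L = ?R \<longleftrightarrow> _")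
proof
  assume eq: "?L = ?R"
  have "Poly_Mapping.lookup ?L j = Poly_Mapping.lookup ?R j" by (rule arg_cong[OF eq])
  then have jl: "j = l" using assms by (auto simp: lookup_add lookup_single when_def split: if_splits)
  then have "Poly_Mapping.single i (1::nat) = Poly_Mapping.single k 1" using eq by simp
  then have "Poly_Mapping.lookup (Poly_Mapping.single i (1::nat)) i = Poly_Mapping.lookup (Poly_Mapping.single k 1) i" by simp
  then show "i = k \<and> j = l" using jl by (auto simp: lookup_single when_def split: if_splits)
qed auto

lemma lookup_frob_form:
  assumes "q > 1" "k \<le> n" "l \<le> n"
  shows "Poly_Mapping.lookup (frob_form q n A) (Poly_Mapping.single k 1 + Poly_Mapping.single l q) = A $$ (k, l)"
proof -
  have "Poly_Mapping.lookup (frob_form q n A) (Poly_Mapping.single k 1 + Poly_Mapping.single l q)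
      = (\<Sum>i\<le>n. \<Sum>j\<le>n. if i = k \<and> j = l then A $$ (i, j) else 0)"
    unfolding frob_form_def frob_monomial lookup_sum lookup_single
    by (simp only: frob_exponent_inject[OF assms(1)] when_def)
  also have "\<dots> = (\<Sum>i\<le>n. if i = k then A $$ (i, l) else 0)"
    using assms(3) by (intro sum.cong refl) (auto simp: if_distrib cong: if_cong)
  also have "\<dots> = A $$ (k, l)" using assms(2) by simp
  finally show ?thesis .
qed

text \<open>
  The total degree in the variables \<open>x_0, ..., x_n\<close>; with a fixed set of variables it is additive
  without any case distinction.
\<close>

definition mdeg :: "nat \<Rightarrow> (nat \<Rightarrow>\<^sub>0 nat) \<Rightarrow> nat" where
  "mdeg n m = (\<Sum>i\<le>n. Poly_Mapping.lookup m i)"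

lemma mdeg_add: "mdeg n (a + b) = mdeg n a + mdeg n b"
  by (simp add: mdeg_def lookup_add sum.distrib)

lemma mdeg_single: "i \<le> n \<Longrightarrow> mdeg n (Poly_Mapping.single i k) = k"
  by (simp add: mdeg_def lookup_single when_def)

lemma frob_form_homogeneous:
  assumes "m \<in> Poly_Mapping.keys (frob_form q n A)" shows "mdeg n m = q + 1"
proof -
  have "Poly_Mapping.lookup (frob_form q n A) m = 0" if "mdeg n m \<noteq> q + 1"
    unfolding frob_form_def frob_monomial lookup_sum lookup_single
    using that by (intro sum.neutral ballI) (auto simp: when_def mdeg_add mdeg_single)
  then show ?thesis using assms by (auto simp: in_keys_iff)
qed

text \<open>
  In degree d, a multiple of a form of degree d only sees the constant term of the factor.  So two
  forms of the same degree that generate the same ideal are proportional, without any discussion of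
  units.
\<close>

lemma lookup_mult_homogeneous:
  fixes F G :: "'k::comm_ring_1 mpoly"
  assumes "G \<in> coord_ring n" "\<And>m. m \<in> Poly_Mapping.keys F \<Longrightarrow> mdeg n m = d" "mdeg n m = d"
  shows "Poly_Mapping.lookup (G * F) m = Poly_Mapping.lookup G 0 * Poly_Mapping.lookup F m"
proof -
  define c where "c = Poly_Mapping.lookup G 0"
  define G1 where "G1 = G - Const c"
  have "m \<notin> Poly_Mapping.keys (G1 * F)"
  proof
    assume "m \<in> Poly_Mapping.keys (G1 * F)"
    then obtain a b where ab: "m = a + b" "a \<in> Poly_Mapping.keys G1" "b \<in> Poly_Mapping.keys F"
      using keys_mult[of G1 F] by auto
    then have "mdeg n a = 0" using assms(2)[of b] assms(3) by (simp add: mdeg_add)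
    then have low: "Poly_Mapping.lookup a i = 0" if "i \<le> n" for i
      using that by (simp add: mdeg_def)
    have "Poly_Mapping.lookup G1 0 = 0"
      by (simp add: G1_def c_def lookup_minus Const_def)
    then have "a \<noteq> 0" using ab(2) by (auto simp: in_keys_iff)
    then have "a \<in> Poly_Mapping.keys G"
      using ab(2) by (auto simp: G1_def in_keys_iff lookup_minus Const_def lookup_single when_def)
    then have "Poly_Mapping.keys a \<subseteq> {..n}" using assms(1) by (auto simp: coord_ring_def)
    then have "a = 0" using low by (intro poly_mapping_eqI) (metis atMost_iff in_keys_iff lookup_zero subsetD)
    with \<open>a \<noteq> 0\<close> show False ..
  qed
  then have "Poly_Mapping.lookup (G1 * F) m = 0" by (simp add: in_keys_iff)
  moreover have "G * F = Const c * F + G1 * F" by (simp add: G1_def algebra_simps)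
  ultimately show ?thesis by (simp add: lookup_add lookup_Const_mult c_def)
qed

lemma invertible_mat_inverse:
  assumes "T \<in> carrier_mat m m" "invertible_mat T"
  obtains S where "S \<in> carrier_mat m m" "S * T = 1\<^sub>m m" "T * S = 1\<^sub>m m"
proof -
  obtain S where "inverts_mat T S" "inverts_mat S T"
    using assms(2) by (auto simp: invertible_mat_def)
  then have ST: "S * T = 1\<^sub>m (dim_row S)" "T * S = 1\<^sub>m m"
    using assms(1) by (auto simp: inverts_mat_def)
  have "dim_col S = m" using arg_cong[OF ST(2), of dim_col] by simp
  moreover have "dim_row S = m" using arg_cong[OF ST(1), of dim_col] assms(1) by simp
  ultimately show ?thesis using that[of S] ST by auto
qed

text \<open>
  The pullback along T is a ring automorphism of the coordinate ring, with the pullback along the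
  inverse of T as inverse, so it maps principal ideals to principal ideals.
\<close>

lemma proj_isomorphic_X_hypI:
  fixes A :: "'k::comm_ring_1 mat"
  assumes p: "prime CHAR('k)" "q = CHAR('k) ^ e"
    and T: "T \<in> carrier_mat (n + 1) (n + 1)" "invertible_mat T"
    and eq: "\<And>k l. k \<le> n \<Longrightarrow> l \<le> n \<Longrightarrow> pullback_mat q n T A $$ (k, l) = B $$ (k, l)"
  shows "proj_isomorphic n (X_hyp q n A) (X_hyp q n B)"
proof -
  have FB: "lin_pullback n T (frob_form q n A) = frob_form q n B"
    unfolding lin_pullback_frob_form[OF p] by (simp add: frob_form_def eq)
  obtain S where S: "S \<in> carrier_mat (n + 1) (n + 1)" and ST: "S * T = 1\<^sub>m (n + 1)"
    using invertible_mat_inverse[OF T] .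
  have "lin_pullback n T ` X_hyp q n A = X_hyp q n B"
  proof
    show "lin_pullback n T ` X_hyp q n A \<subseteq> X_hyp q n B"
      by (auto simp: X_hyp_def hypersurface_def lin_pullback_mult FB intro: coord_ring_lin_pullback)
    show "X_hyp q n B \<subseteq> lin_pullback n T ` X_hyp q n A"
    proof
      fix H assume "H \<in> X_hyp q n B"
      then obtain G where G: "G \<in> coord_ring n" "H = G * frob_form q n B"
        by (auto simp: X_hyp_def hypersurface_def)
      have "lin_pullback n T (lin_pullback n S G) = G"
        using ST by (simp add: lin_pullback_comp[OF S T(1) G(1)] lin_pullback_one[OF G(1), simplified])
      then have "H = lin_pullback n T (lin_pullback n S G * frob_form q n A)"
        by (simp add: lin_pullback_mult FB G(2))
      then show "H \<in> lin_pullback n T ` X_hyp q n A"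
        using coord_ring_lin_pullback[OF G(1)] by (auto simp: X_hyp_def hypersurface_def)
    qed
  qed
  then show ?thesis using T by (auto simp: proj_isomorphic_def)
qed

lemma proj_isomorphic_X_hypD:
  fixes A :: "'k::comm_ring_1 mat"
  assumes p: "prime CHAR('k)" "q = CHAR('k) ^ e" "q > 1"
    and iso: "proj_isomorphic n (X_hyp q n A) (X_hyp q n B)"
  obtains T c where "T \<in> carrier_mat (n + 1) (n + 1)" "invertible_mat T"
    "\<And>k l. k \<le> n \<Longrightarrow> l \<le> n \<Longrightarrow> pullback_mat q n T A $$ (k, l) = c * B $$ (k, l)"
proof -
  obtain T where T: "T \<in> carrier_mat (n + 1) (n + 1)" "invertible_mat T"
    and im: "lin_pullback n T ` X_hyp q n A = X_hyp q n B"
    using iso by (auto simp: proj_isomorphic_def)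
  have "1 * frob_form q n A \<in> X_hyp q n A"
    unfolding X_hyp_def hypersurface_def using coord_ring_Const[of 1 n] by (force simp del: mult_1_left)
  then have "lin_pullback n T (frob_form q n A) \<in> X_hyp q n B"
    using im by (simp add: image_iff set_eq_iff) (metis)
  then obtain G where G: "G \<in> coord_ring n" "frob_form q n (pullback_mat q n T A) = G * frob_form q n B"
    by (auto simp: X_hyp_def hypersurface_def lin_pullback_frob_form[OF p(1,2)])
  show ?thesis
  proof (rule that[OF T])
    fix k l assume kl: "k \<le> n" "l \<le> n"
    let ?m = "Poly_Mapping.single k 1 + Poly_Mapping.single l q"
    have "Poly_Mapping.lookup (G * frob_form q n B) ?m = Poly_Mapping.lookup G 0 * Poly_Mapping.lookup (frob_form q n B) ?m"
      using kl by (intro lookup_mult_homogeneous[OF G(1)]) (auto simp: mdeg_add mdeg_single dest: frob_form_homogeneous)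
    then show "pullback_mat q n T A $$ (k, l) = Poly_Mapping.lookup G 0 * B $$ (k, l)"
      unfolding G(2)[symmetric] lookup_frob_form[OF p(3) kl] .
  qed
qed

section \<open>Matrices as forms on a coordinate space\<close>

text \<open>
  All columns but one can be chosen independent; a vector of the kernel that vanishes at the
  remaining index is a linear relation between independent columns.  In particular the kernel has
  dimension at most one.
\<close>

lemma (in vec_space) corank_one_kernel:
  assumes A: "A \<in> carrier_mat n (Suc r)" and rank: "rank A = r"
  shows "\<exists>j0\<le>r. \<forall>z\<in>carrier_vec (Suc r). A *\<^sub>v z = 0\<^sub>v n \<longrightarrow> vec_index z j0 = 0 \<longrightarrow> z = 0\<^sub>v (Suc r)"
proof -
  have "lin_indpt {}" by (auto simp: lin_dep_def)
  then obtain S where S: "maximal S (\<lambda>T. T \<subseteq> set (cols A) \<and> lin_indpt T)"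
    using maximal_exists_superset[of "set (cols A)" "\<lambda>T. T \<subseteq> set (cols A) \<and> lin_indpt T" "{}"] by auto
  then have Sc: "S \<subseteq> set (cols A)" and ind: "lin_indpt S" by (auto simp: maximal_def)
  have card: "card S = r" using rank_card_indpt[OF A S] rank by simp
  have finS: "finite S" using Sc by (rule finite_subset) simp
  have SV: "S \<subseteq> carrier_vec n" using Sc cols_dim[of A] A by auto
  have "\<exists>j<Suc r. col A j = x" if "x \<in> S" for x
  proof -
    have "set (cols A) = col A ` {..<Suc r}" using A by (simp add: cols_def atLeast0LessThan del: upt_Suc)
    then have "x \<in> col A ` {..<Suc r}" using that Sc by (simp add: subset_iff)
    then show ?thesis by (simp add: image_iff Bex_def eq_commute)
  qed
  then obtain j where j: "\<And>x. x \<in> S \<Longrightarrow> j x < Suc r" "\<And>x. x \<in> S \<Longrightarrow> col A (j x) = x" by metis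
  have inj: "inj_on j S" using j(2) by (metis inj_onI)
  have "card ({..<Suc r} - j ` S) = 1"
    using j(1) finS by (subst card_Diff_subset) (auto simp: card_image[OF inj] card)
  then obtain j0 where j0: "{..<Suc r} - j ` S = {j0}" by (auto simp: card_1_singleton_iff)
  show ?thesis
  proof (intro exI[of _ j0] conjI ballI impI)
    show "j0 \<le> r" using j0 by auto
    fix z assume z: "z \<in> carrier_vec (Suc r)" "A *\<^sub>v z = 0\<^sub>v n" "vec_index z j0 = 0"
    have "lincomb (\<lambda>x. vec_index z (j x)) S = 0\<^sub>v n"
    proof (rule eq_vecI)
      fix i assume i: "i < dim_vec (0\<^sub>v n)"
      then have "vec_index (lincomb (\<lambda>x. vec_index z (j x)) S) i = (\<Sum>x\<in>S. vec_index z (j x) * vec_index x i)"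
        by (simp add: lincomb_index SV)
      also have "\<dots> = (\<Sum>x\<in>S. vec_index z (j x) * A $$ (i, j x))"
      proof (rule sum.cong[OF refl])
        fix x assume "x \<in> S"
        then have "vec_index (col A (j x)) i = A $$ (i, j x)" using A i j(1) by simp
        then show "vec_index z (j x) * vec_index x i = vec_index z (j x) * A $$ (i, j x)"
          using j(2)[OF \<open>x \<in> S\<close>] by simp
      qed
      also have "\<dots> = (\<Sum>k\<in>j ` S. vec_index z k * A $$ (i, k))"
        by (simp add: sum.reindex[OF inj])
      also have "\<dots> = (\<Sum>k<Suc r. vec_index z k * A $$ (i, k))"
        using j0 z(3) j(1) by (intro sum.mono_neutral_left) auto
      also have "\<dots> = vec_index (A *\<^sub>v z) i"
        using A i z(1) by (simp add: scalar_prod_def atLeast0LessThan mult.commute del: sum.lessThan_Suc)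
      finally show "vec_index (lincomb (\<lambda>x. vec_index z (j x)) S) i = vec_index (0\<^sub>v n) i" using z(2) by simp
    qed (simp add: lincomb_dim finS SV)
    then have zero: "vec_index z (j x) = 0" if "x \<in> S" for x
      using lin_dep_crit[OF finS order_refl _ that, of "\<lambda>x. vec_index z (j x)"] ind by auto
    show "z = 0\<^sub>v (Suc r)"
    proof (rule eq_vecI)
      fix k assume "k < dim_vec (0\<^sub>v (Suc r))"
      then have "k = j0 \<or> k \<in> j ` S" using j0 by auto
      then show "vec_index z k = vec_index (0\<^sub>v (Suc r)) k" using z(3) zero \<open>k < _\<close> by auto
    qed (use z(1) in simp)
  qed
qed

lemma sum_fun_apply: "(\<Sum>i\<in>I. F i) x = (\<Sum>i\<in>I. F i x)"
  by (induction I rule: infinite_finite_induct) simp_all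

text \<open>
  Coordinate vectors are functions on the natural numbers that vanish beyond n.  Thus all
  dimensions share one type, and the abstract results apply to \<open>coord_space n\<close> as a subspace.
\<close>

definition coord_scale :: "'k::times \<Rightarrow> (nat \<Rightarrow> 'k) \<Rightarrow> nat \<Rightarrow> 'k" where
  "coord_scale c x = (\<lambda>i. c * x i)"

definition coord_space :: "nat \<Rightarrow> (nat \<Rightarrow> 'k::zero) set" where
  "coord_space n = {x. \<forall>i>n. x i = 0}"

definition unit_fun :: "nat \<Rightarrow> nat \<Rightarrow> 'k::zero_neq_one" where
  "unit_fun i = (\<lambda>j. if j = i then 1 else 0)"

lemma subspace_dimension_coord_scale:
  "subspace_dimension (coord_scale :: 'k::field \<Rightarrow> (nat \<Rightarrow> 'k) \<Rightarrow> _)"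
  by unfold_locales (auto simp: coord_scale_def fun_eq_iff algebra_simps)

lemma coord_space_expand:
  assumes "x \<in> coord_space n"
  shows "x = (\<Sum>i\<le>n. coord_scale (x i) (unit_fun i :: nat \<Rightarrow> 'k::field))"
proof
  fix j
  have "(\<Sum>i\<le>n. coord_scale (x i) (unit_fun i)) j = (\<Sum>i\<le>n. if j = i then x i else 0)"
    unfolding sum_fun_apply by (intro sum.cong) (auto simp: coord_scale_def unit_fun_def)
  then show "x j = (\<Sum>i\<le>n. coord_scale (x i) (unit_fun i)) j"
    using assms by (auto simp: coord_space_def)
qed

lemma coord_space_has_dim:
  "subspace_dimension.has_dim coord_scale (coord_space n :: (nat \<Rightarrow> 'k::field) set) (n + 1)"
proof -
  interpret subspace_dimension "coord_scale :: 'k \<Rightarrow> (nat \<Rightarrow> 'k) \<Rightarrow> _"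
    by (rule subspace_dimension_coord_scale)
  let ?B = "(unit_fun :: nat \<Rightarrow> nat \<Rightarrow> 'k) ` {..n}"
  have inj: "inj_on (unit_fun :: nat \<Rightarrow> nat \<Rightarrow> 'k) {..n}"
    by (rule inj_onI) (auto simp: unit_fun_def fun_eq_iff split: if_splits)
  have sub: "subspace (coord_space n :: (nat \<Rightarrow> 'k) set)"
    by (rule subspaceI) (auto simp: coord_space_def coord_scale_def)
  have "span ?B = coord_space n"
  proof
    show "span ?B \<subseteq> coord_space n"
      by (rule span_minimal[OF _ sub]) (auto simp: coord_space_def unit_fun_def)
    show "coord_space n \<subseteq> span ?B"
    proof
      fix x :: "nat \<Rightarrow> 'k" assume x: "x \<in> coord_space n"
      have "(\<Sum>i\<le>n. coord_scale (x i) (unit_fun i)) \<in> span ?B"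
        by (intro span_sum span_scale span_base) auto
      then show "x \<in> span ?B" using coord_space_expand[OF x] by simp
    qed
  qed
  moreover have "independent ?B"
  proof (rule independent_if_scalars_zero)
    fix f :: "(nat \<Rightarrow> 'k) \<Rightarrow> 'k" and x
    assume *: "(\<Sum>x\<in>?B. coord_scale (f x) x) = 0" and "x \<in> ?B"
    then obtain j where j: "j \<le> n" "x = unit_fun j" by auto
    have "(\<Sum>x\<in>?B. coord_scale (f x) x) j = (\<Sum>i\<le>n. if j = i then f (unit_fun i) else 0)"
      unfolding sum.reindex[OF inj] sum_fun_apply
      by (intro sum.cong) (auto simp: coord_scale_def unit_fun_def)
    then show "f x = 0" using * j by simp
  qed simp
  moreover have "card ?B = n + 1" using card_image[OF inj] by simp
  ultimately show ?thesis by (auto simp: has_dim_def)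
qed

lemma frobenius_form_mat_form:
  assumes "prime CHAR('k::alg_closed_field)" "q = CHAR('k) ^ e" "q > 1"
  shows "frobenius_form coord_scale (mat_form q n (A :: 'k mat)) q"
proof -
  interpret subspace_dimension "coord_scale :: 'k \<Rightarrow> (nat \<Rightarrow> 'k) \<Rightarrow> _"
    by (rule subspace_dimension_coord_scale)
  have frob: "(a + b) ^ q = a ^ q + b ^ q" for a b :: 'k
    by (rule freshmans_dream'[OF assms(1,2)])
  show ?thesis
    by unfold_locales
      (use assms(3) in \<open>auto simp: frob mat_form_def coord_scale_def algebra_simps sum.distrib
        power_mult_distrib sum_distrib_left\<close>)
qed

definition lin_map :: "nat \<Rightarrow> 'k::semiring_0 mat \<Rightarrow> (nat \<Rightarrow> 'k) \<Rightarrow> nat \<Rightarrow> 'k" where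
  "lin_map n T x = (\<lambda>i. if i \<le> n then \<Sum>k\<le>n. T $$ (i, k) * x k else 0)"

lemma lin_map_coord_space: "lin_map n T x \<in> coord_space n"
  by (simp add: lin_map_def coord_space_def)

lemma lin_map_mult:
  assumes "S \<in> carrier_mat (n + 1) (n + 1)" "T \<in> carrier_mat (n + 1) (n + 1)"
  shows "lin_map n S (lin_map n T x) = lin_map n (S * T) x"
proof
  fix i
  have "(\<Sum>k\<le>n. S $$ (i, k) * (\<Sum>j\<le>n. T $$ (k, j) * x j)) = (\<Sum>j\<le>n. (S * T) $$ (i, j) * x j)" if "i \<le> n"
  proof -
    have "(\<Sum>k\<le>n. S $$ (i, k) * (\<Sum>j\<le>n. T $$ (k, j) * x j)) = (\<Sum>j\<le>n. \<Sum>k\<le>n. S $$ (i, k) * T $$ (k, j) * x j)"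
      unfolding sum_distrib_left by (subst sum.swap) (simp add: mult.assoc)
    also have "\<dots> = (\<Sum>j\<le>n. (S * T) $$ (i, j) * x j)"
      using assms that
      by (intro sum.cong refl) (simp add: scalar_prod_def atLeast0LessThan lessThan_Suc_atMost sum_distrib_right)
    finally show ?thesis .
  qed
  then show "lin_map n S (lin_map n T x) i = lin_map n (S * T) x i" by (simp add: lin_map_def)
qed

lemma lin_map_one:
  fixes x :: "nat \<Rightarrow> 'k::comm_ring_1"
  assumes "x \<in> coord_space n" shows "lin_map n (1\<^sub>m (n + 1)) x = x"
proof
  fix i
  have "(\<Sum>k\<le>n. (1\<^sub>m (n + 1)) $$ (i, k) * x k) = (\<Sum>k\<le>n. if i = k then x k else 0)" if "i \<le> n"
    using that by (intro sum.cong) auto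
  then show "lin_map n (1\<^sub>m (n + 1)) x i = x i"
    using assms by (auto simp: lin_map_def coord_space_def)
qed

text \<open>
  Both sides are expanded in the columns t of T, whose mutual products are the entries of the
  transformed matrix.
\<close>

lemma mat_form_lin_map:
  fixes A :: "'k::alg_closed_field mat"
  assumes "prime CHAR('k)" "q = CHAR('k) ^ e" "q > 1"
  shows "mat_form q n A (lin_map n T x) (lin_map n T y) = mat_form q n (pullback_mat q n T A) x y"
proof -
  interpret frobenius_form coord_scale "mat_form q n A" q
    by (rule frobenius_form_mat_form[OF assms])
  define t where "t k = (\<lambda>i. if i \<le> n then T $$ (i, k) else 0)" for k
  have lin: "lin_map n T x = (\<Sum>k\<le>n. coord_scale (x k) (t k))" for x
    by (rule ext) (simp add: sum_fun_apply lin_map_def coord_scale_def t_def mult.commute)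
  have "mat_form q n A (lin_map n T x) (lin_map n T y) = (\<Sum>k\<le>n. \<Sum>l\<le>n. x k * (y l ^ q * mat_form q n A (t k) (t l)))"
    unfolding lin unfolding sum_left unfolding sum_right sum_distrib_left ..
  also have "\<dots> = (\<Sum>k\<le>n. \<Sum>l\<le>n. pullback_mat q n T A $$ (k, l) * x k * y l ^ q)"
    by (intro sum.cong refl) (simp add: pullback_mat_def mat_form_def t_def algebra_simps)
  finally show ?thesis by (simp add: mat_form_def)
qed

lemma W_mat_entry:
  assumes "s \<le> n" "i \<le> n" "j \<le> n"
  shows "W_mat n s $$ (i, j) = (normal_entry s i j :: 'k::zero_neq_one)"
proof -
  have "i - s < n - s + 1" "j - s < n - s + 1" using assms by auto
  then show ?thesis using assms
    by (auto simp: W_mat_def E_mat_def normal_entry_def)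
qed

text \<open>
  The rank makes the right radical at most a line, so a normal basis exists, and its vectors are the
  columns of T.  The case of a purely orthonormal basis is excluded because A is singular.
\<close>

lemma normal_form_exists:
  fixes A :: "'k::alg_closed_field mat"
  assumes p: "prime CHAR('k)" "q = CHAR('k) ^ e" "q > 1"
    and A: "A \<in> carrier_mat (n + 1) (n + 1)" and rank: "vec_space.rank (n + 1) A = n"
  shows "\<exists>s\<le>n. proj_isomorphic n (X_hyp q n A) (X_hyp q n (W_mat n s))"
proof -
  interpret frobenius_form coord_scale "mat_form q n A" q
    by (rule frobenius_form_mat_form[OF p])
  let ?V = "coord_space n :: (nat \<Rightarrow> 'k) set"
  have V: "has_dim ?V (n + 1)" by (rule coord_space_has_dim)
  define fv where "fv y = vec (n + 1) (\<lambda>j. y j ^ q)" for y :: "nat \<Rightarrow> 'k"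
  have form_unit: "mat_form q n A (unit_fun i) y = vec_index (A *\<^sub>v fv y) i" if i: "i \<le> n" for i y
  proof -
    have "mat_form q n A (unit_fun i) y = (\<Sum>k\<le>n. if k = i then \<Sum>j\<le>n. A $$ (i, j) * y j ^ q else 0)"
      unfolding mat_form_def by (intro sum.cong refl) (auto simp: unit_fun_def)
    also have "\<dots> = (\<Sum>j\<le>n. A $$ (i, j) * y j ^ q)" using i by simp
    also have "\<dots> = vec_index (A *\<^sub>v fv y) i"
      using A i by (simp add: fv_def scalar_prod_def atLeast0LessThan lessThan_Suc_atMost)
    finally show ?thesis .
  qed
  \<comment> \<open>The right radical consists of the entrywise q-th roots of the vectors in the kernel of A.\<close>
  have radical: "(\<forall>x\<in>?V. mat_form q n A x y = 0) \<longleftrightarrow> A *\<^sub>v fv y = 0\<^sub>v (n + 1)" for y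
  proof
    assume *: "\<forall>x\<in>?V. mat_form q n A x y = 0"
    show "A *\<^sub>v fv y = 0\<^sub>v (n + 1)"
    proof (rule eq_vecI)
      fix i assume "i < dim_vec (0\<^sub>v (n + 1))"
      then have i: "i \<le> n" by simp
      then have "unit_fun i \<in> ?V" by (auto simp: coord_space_def unit_fun_def)
      then show "vec_index (A *\<^sub>v fv y) i = vec_index (0\<^sub>v (n + 1)) i"
        using form_unit[OF i, of y] * i by simp
    qed (use A in simp)
  next
    assume *: "A *\<^sub>v fv y = 0\<^sub>v (n + 1)"
    show "\<forall>x\<in>?V. mat_form q n A x y = 0"
    proof
      fix x assume "x \<in> ?V"
      then have "mat_form q n A x y = (\<Sum>i\<le>n. x i * mat_form q n A (unit_fun i) y)"
        by (subst coord_space_expand) (simp_all only: sum_left)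
      also have "\<dots> = 0" by (intro sum.neutral) (simp add: form_unit *)
      finally show "mat_form q n A x y = 0" .
    qed
  qed
  have fv_0: "y = 0" if "y \<in> ?V" "fv y = 0\<^sub>v (n + 1)" for y
  proof
    fix j
    have "j \<le> n \<Longrightarrow> y j ^ q = 0" using arg_cong[OF that(2), of "\<lambda>v. vec_index v j"] by (simp add: fv_def)
    then show "y j = 0 j" using that(1) by (cases "j \<le> n") (auto simp: coord_space_def)
  qed
  obtain j0 where j0: "j0 \<le> n" "\<And>z. z \<in> carrier_vec (n + 1) \<Longrightarrow> A *\<^sub>v z = 0\<^sub>v (n + 1) \<Longrightarrow> vec_index z j0 = 0 \<Longrightarrow> z = 0\<^sub>v (n + 1)"
    using vec_space.corank_one_kernel[of A "n + 1" n] A rank by auto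
  have rad0: "y = 0" if "y \<in> ?V" "\<forall>x\<in>?V. mat_form q n A x y = 0" "y j0 = 0" for y
  proof (rule fv_0[OF that(1)])
    have "fv y \<in> carrier_vec (n + 1)" by (simp add: fv_def)
    moreover have "A *\<^sub>v fv y = 0\<^sub>v (n + 1)" using radical[of y] that(2) by (rule iffD1)
    moreover have "vec_index (fv y) j0 = 0" using j0(1) that(3) by (simp add: fv_def)
    ultimately show "fv y = 0\<^sub>v (n + 1)" by (rule j0(2))
  qed
  have sV: "subspace ?V" by (rule has_dim_subspace[OF V])
  have "\<exists>y0. \<forall>y\<in>?V. (\<forall>x\<in>?V. mat_form q n A x y = 0) \<longrightarrow> (\<exists>c. y = coord_scale c y0)"
  proof (cases "\<exists>y0\<in>?V. (\<forall>x\<in>?V. mat_form q n A x y0 = 0) \<and> y0 j0 \<noteq> 0")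
    case False
    then show ?thesis using rad0 by (intro exI[of _ 0]) auto
  next
    case True
    then obtain y0 where y0: "y0 \<in> ?V" "\<forall>x\<in>?V. mat_form q n A x y0 = 0" "y0 j0 \<noteq> 0" by blast
    have "\<exists>c. y = coord_scale c y0" if y: "y \<in> ?V" "\<forall>x\<in>?V. mat_form q n A x y = 0" for y
    proof -
      have "y - coord_scale (y j0 / y0 j0) y0 = 0"
      proof (rule rad0)
        show "y - coord_scale (y j0 / y0 j0) y0 \<in> ?V"
          using y(1) y0(1) by (intro subspace_diff[OF sV] subspace_scale[OF sV])
        show "(y - coord_scale (y j0 / y0 j0) y0) j0 = 0"
          using y0(3) by (simp add: coord_scale_def)
      qed (use y y0 in \<open>simp add: form_simps\<close>)
      then have "y = coord_scale (y j0 / y0 j0) y0" by simp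
      then show ?thesis ..
    qed
    then show ?thesis by blast
  qed
  then obtain s b where s: "s \<le> n + 1" and b: "span (b ` {..<n + 1}) = ?V"
    "\<And>i j. i < n + 1 \<Longrightarrow> j < n + 1 \<Longrightarrow> mat_form q n A (b i) (b j) = normal_entry s i j"
    using normal_basis_exists[OF V] by auto
  have bV: "b i \<in> ?V" if "i < n + 1" for i
    using that b(1) span_base[of "b i" "b ` {..<n + 1}"] by auto
  have "s \<noteq> n + 1"
  proof
    assume sn: "s = n + 1"
    have "det A = 0" using vec_space.det_rank_iff[OF A] rank by simp
    then obtain z where z: "z \<in> carrier_vec (n + 1)" "z \<noteq> 0\<^sub>v (n + 1)" "A *\<^sub>v z = 0\<^sub>v (n + 1)"
      using det_0_iff_vec_prod_zero_field[OF A] by auto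
    have "\<forall>j. \<exists>r. r ^ q = vec_index z j" using frob_root by blast
    then obtain r where r: "\<And>j. r j ^ q = vec_index z j" by metis
    define y where "y = (\<lambda>j. if j \<le> n then r j else 0)"
    have "fv y = z" using z(1) by (intro eq_vecI) (auto simp: fv_def y_def r)
    have yV: "y \<in> ?V" by (simp add: y_def coord_space_def)
    obtain a where a: "y = (\<Sum>i<n + 1. coord_scale (a i) (b i))"
      using in_span_image_lessThan[of y b "n + 1"] b(1) yV by auto
    have rad: "\<forall>x\<in>?V. mat_form q n A x y = 0" using radical[of y] z(3) \<open>fv y = z\<close> by simp
    have "a i = 0" if i: "i < n + 1" for i
    proof -
      have "mat_form q n A (b i) y = (\<Sum>j<n + 1. a j ^ q * mat_form q n A (b i) (b j))"
        by (simp only: a sum_right)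
      also have "\<dots> = (\<Sum>j<n + 1. if j = i then a j ^ q else 0)"
        using i sn by (intro sum.cong refl) (auto simp: b(2) normal_entry_def)
      also have "\<dots> = a i ^ q" using i by simp
      finally have "a i ^ q = 0" using rad bV[OF i] by simp
      then show ?thesis by simp
    qed
    then have "y = 0" unfolding a by (intro sum.neutral) (simp add: coord_scale_def zero_fun_def)
    then have "fv y = 0\<^sub>v (n + 1)" using p(3) by (intro eq_vecI) (auto simp: fv_def)
    then show False using z(2) \<open>fv y = z\<close> by simp
  qed
  then have sn: "s \<le> n" using s by simp
  define T where "T = mat (n + 1) (n + 1) (\<lambda>(i, j). b j i)"
  have T: "T \<in> carrier_mat (n + 1) (n + 1)" by (simp add: T_def)
  have "\<exists>c. unit_fun j = (\<Sum>k<n + 1. coord_scale (c k) (b k))" if "j \<le> n" for j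
    using that b(1) in_span_image_lessThan[of "unit_fun j" b "n + 1"]
    by (auto simp: coord_space_def unit_fun_def)
  then obtain c where c: "\<And>j. j \<le> n \<Longrightarrow> unit_fun j = (\<Sum>k<n + 1. coord_scale (c j k) (b k))" by metis
  define S where "S = mat (n + 1) (n + 1) (\<lambda>(k, j). c j k)"
  have S: "S \<in> carrier_mat (n + 1) (n + 1)" by (simp add: S_def)
  have TS: "T * S = 1\<^sub>m (n + 1)"
  proof (rule eq_matI)
    fix i j assume "i < dim_row (1\<^sub>m (n + 1))" "j < dim_col (1\<^sub>m (n + 1))"
    then have ij: "i < n + 1" "j < n + 1" by auto
    have "(T * S) $$ (i, j) = (\<Sum>k<n + 1. b k i * c j k)"
      using ij by (simp add: T_def S_def scalar_prod_def atLeast0LessThan del: sum.lessThan_Suc)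
    also have "\<dots> = unit_fun j i"
      using ij by (subst c) (simp_all add: sum_fun_apply coord_scale_def mult.commute del: sum.lessThan_Suc)
    finally show "(T * S) $$ (i, j) = 1\<^sub>m (n + 1) $$ (i, j)" using ij by (simp add: unit_fun_def)
  qed (use T S in auto)
  have "invertible_mat T"
    unfolding invertible_mat_def inverts_mat_def
    using TS mat_mult_left_right_inverse[OF T S TS] T S by auto
  moreover have "pullback_mat q n T A $$ (k, l) = W_mat n s $$ (k, l)" if kl: "k \<le> n" "l \<le> n" for k l
  proof -
    have "pullback_mat q n T A $$ (k, l) = mat_form q n A (b k) (b l)"
      using kl by (simp add: pullback_mat_def mat_form_def T_def)
    then show ?thesis using kl b(2)[of k l] W_mat_entry[OF sn kl, where 'k = 'k] by simp
  qed
  ultimately show ?thesis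
    using proj_isomorphic_X_hypI[OF p(1,2) T] sn by blast
qed

section \<open>The chain of iterated orthogonal spaces\<close>

definition right_perp :: "nat \<Rightarrow> nat \<Rightarrow> 'k::comm_semiring_1 mat \<Rightarrow> (nat \<Rightarrow> 'k) set \<Rightarrow> (nat \<Rightarrow> 'k) set" where
  "right_perp q n A S = {y \<in> coord_space n. \<forall>x\<in>S. mat_form q n A x y = 0}"

definition perp_chain :: "nat \<Rightarrow> nat \<Rightarrow> 'k::comm_semiring_1 mat \<Rightarrow> nat \<Rightarrow> (nat \<Rightarrow> 'k) set" where
  "perp_chain q n A m = (right_perp q n A ^^ m) (coord_space n)"

lemma perp_chain_subset: "perp_chain q n A m \<subseteq> coord_space n"
  by (cases m) (auto simp: perp_chain_def right_perp_def)

text \<open>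
  The orthogonal spaces depend on the vanishing of the form only, so a similitude \<open>\<tau>\<close>, not just an
  isometry, transports the chain.
\<close>

lemma perp_chain_image:
  assumes maps: "\<And>x. x \<in> coord_space n \<Longrightarrow> \<tau> x \<in> coord_space n"
    and surj: "\<And>y. y \<in> coord_space n \<Longrightarrow> \<exists>x\<in>coord_space n. \<tau> x = y"
    and form: "\<And>x y. x \<in> coord_space n \<Longrightarrow> y \<in> coord_space n \<Longrightarrow>
      mat_form q n A (\<tau> x) (\<tau> y) = c * mat_form q n B x y"
    and c: "(c :: 'k::idom) \<noteq> 0"
  shows "perp_chain q n A m = \<tau> ` perp_chain q n B m"
proof (induction m)
  case 0
  then show ?case using maps surj by (force simp: perp_chain_def)
next
  case (Suc m)
  let ?S = "perp_chain q n B m"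
  have S: "?S \<subseteq> coord_space n" by (rule perp_chain_subset)
  have "right_perp q n A (\<tau> ` ?S) = \<tau> ` right_perp q n B ?S"
  proof (intro Set.set_eqI iffI)
    fix y assume y: "y \<in> right_perp q n A (\<tau> ` ?S)"
    then obtain x where x: "x \<in> coord_space n" "y = \<tau> x" using surj[of y] by (auto simp: right_perp_def)
    then have "x \<in> right_perp q n B ?S" using y S c form by (fastforce simp: right_perp_def)
    then show "y \<in> \<tau> ` right_perp q n B ?S" using x by blast
  next
    fix y assume "y \<in> \<tau> ` right_perp q n B ?S"
    then obtain x where "x \<in> right_perp q n B ?S" "y = \<tau> x" by blast
    then show "y \<in> right_perp q n A (\<tau> ` ?S)" using S form maps by (auto simp: right_perp_def subset_iff)
  qed
  then show ?case using Suc by (simp add: perp_chain_def)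
qed

lemma mat_form_W_unit:
  fixes y :: "nat \<Rightarrow> 'k::comm_ring_1"
  assumes "s \<le> n" "i \<le> n" "q > 0"
  shows "mat_form q n (W_mat n s) (unit_fun i) y
    = (if i < s then y i ^ q else if i = s then 0 else y (i - 1) ^ q)"
proof -
  have "mat_form q n (W_mat n s) (unit_fun i) y
      = (\<Sum>k\<le>n. if k = i then \<Sum>j\<le>n. normal_entry s i j * y j ^ q else 0)"
    unfolding mat_form_def using assms by (intro sum.cong refl) (auto simp: unit_fun_def W_mat_entry)
  also have "\<dots> = (\<Sum>j\<le>n. normal_entry s i j * y j ^ q)" using assms by simp
  also have "\<dots> = (\<Sum>j\<le>n. if j = (if i < s then i else i - 1) \<and> i \<noteq> s then y j ^ q else 0)"
    using assms by (intro sum.cong refl) (auto simp: normal_entry_def)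
  also have "\<dots> = (if i < s then y i ^ q else if i = s then 0 else y (i - 1) ^ q)"
    using assms by (cases "i = s") auto
  finally show ?thesis .
qed

text \<open>
  The coordinates that occur in the m-th term of the chain of \<open>W_s\<close>.  Taking orthogonal spaces
  complements the coordinates below s.  On the nilpotent block it complements and shifts by one
  towards smaller indices, and it always contains the last coordinate.  So the set alternates at an index
  \<open>j \<ge> s\<close> until, after \<open>n - j\<close> steps, the effect of the last coordinate has reached j; from
  then on it is constant there.
\<close>

definition chain_index :: "nat \<Rightarrow> nat \<Rightarrow> nat \<Rightarrow> nat \<Rightarrow> bool" where
  "chain_index n s m j \<longleftrightarrow> (if j < s then even m else even (min m (n - j)))"

lemma perp_chain_W:
  assumes "s \<le> n" "q > 0"
  shows "perp_chain q n (W_mat n s :: 'k::idom mat) m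
    = {y \<in> coord_space n. \<forall>j\<le>n. y j \<noteq> 0 \<longrightarrow> chain_index n s m j}"
proof (induction m)
  case 0
  then show ?case by (simp add: perp_chain_def chain_index_def)
next
  case (Suc m)
  let ?W = "W_mat n s :: 'k mat" and ?S = "perp_chain q n (W_mat n s :: 'k mat) m"
  have unit: "unit_fun i \<in> ?S" if "i \<le> n" "chain_index n s m i" for i
    using that unfolding Suc by (auto simp: coord_space_def unit_fun_def)
  have expand: "mat_form q n ?W x y = (\<Sum>i\<le>n. x i * mat_form q n ?W (unit_fun i) y)" for x y
  proof -
    have "mat_form q n ?W (unit_fun i) y = (\<Sum>j\<le>n. ?W $$ (i, j) * y j ^ q)" if "i \<le> n" for i
    proof -
      have "mat_form q n ?W (unit_fun i) y = (\<Sum>k\<le>n. if k = i then \<Sum>j\<le>n. ?W $$ (i, j) * y j ^ q else 0)"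
        unfolding mat_form_def by (intro sum.cong refl) (auto simp: unit_fun_def)
      then show ?thesis using that by simp
    qed
    then show ?thesis by (simp add: mat_form_def sum_distrib_left algebra_simps)
  qed
  have "y \<in> right_perp q n ?W ?S \<longleftrightarrow>
      y \<in> coord_space n \<and> (\<forall>i\<le>n. chain_index n s m i \<longrightarrow> mat_form q n ?W (unit_fun i) y = 0)" for y
  proof
    assume "y \<in> right_perp q n ?W ?S"
    then show "y \<in> coord_space n \<and> (\<forall>i\<le>n. chain_index n s m i \<longrightarrow> mat_form q n ?W (unit_fun i) y = 0)"
      using unit by (auto simp: right_perp_def)
  next
    assume *: "y \<in> coord_space n \<and> (\<forall>i\<le>n. chain_index n s m i \<longrightarrow> mat_form q n ?W (unit_fun i) y = 0)"
    have "mat_form q n ?W x y = 0" if "x \<in> ?S" for x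
      unfolding expand[of x] using that * unfolding Suc by (intro sum.neutral) auto
    then show "y \<in> right_perp q n ?W ?S" using * by (auto simp: right_perp_def)
  qed
  moreover have "(\<forall>i\<le>n. chain_index n s m i \<longrightarrow> mat_form q n ?W (unit_fun i) y = 0)
      \<longleftrightarrow> (\<forall>j\<le>n. y j \<noteq> 0 \<longrightarrow> chain_index n s (Suc m) j)" for y
  proof (intro iffI allI impI)
    fix j assume *: "\<forall>i\<le>n. chain_index n s m i \<longrightarrow> mat_form q n ?W (unit_fun i) y = 0"
      and j: "j \<le> n" "y j \<noteq> 0"
    consider "j < s" | "s \<le> j" "j < n" | "s \<le> j" "j = n" using j by linarith
    then show "chain_index n s (Suc m) j"
    proof cases
      case 1
      then have "\<not> chain_index n s m j" using *[rule_format, of j] j assms by (auto simp: mat_form_W_unit)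
      then show ?thesis using 1 by (simp add: chain_index_def)
    next
      case 2
      then have "\<not> chain_index n s m (Suc j)"
        using *[rule_format, of "Suc j"] j assms by (auto simp: mat_form_W_unit)
      moreover have "n - j = Suc (n - Suc j)" using 2 by simp
      ultimately show ?thesis using 2 by (simp add: chain_index_def)
    next
      case 3
      then show ?thesis by (simp add: chain_index_def)
    qed
  next
    fix i assume *: "\<forall>j\<le>n. y j \<noteq> 0 \<longrightarrow> chain_index n s (Suc m) j" and i: "i \<le> n" "chain_index n s m i"
    consider "i < s" | "i = s" | "s < i" by linarith
    then show "mat_form q n ?W (unit_fun i) y = 0"
    proof cases
      case 1
      then have "y i = 0" using * i by (auto simp: chain_index_def)
      then show ?thesis using 1 i assms by (simp add: mat_form_W_unit)
    next
      case 2
      then show ?thesis using i assms by (simp add: mat_form_W_unit)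
    next
      case 3
      have "n - (i - 1) = Suc (n - i)" "\<not> i - 1 < s" using 3 i by auto
      then have "\<not> chain_index n s (Suc m) (i - 1)" using 3 i by (auto simp: chain_index_def)
      moreover have "i - 1 \<le> n" using i by simp
      ultimately have "y (i - 1) = 0" using * by blast
      then show ?thesis using 3 i assms by (simp add: mat_form_W_unit)
    qed
  qed
  ultimately show ?case by (auto simp: perp_chain_def)
qed

text \<open>
  Coordinates below s alternate with period two and do not matter.  On the nilpotent block, the first
  index is the last one to become constant; it does so after \<open>n - s\<close>
  steps.  For smaller m, the index j with \<open>n - j = m + 1\<close> has a different status in the two terms.
\<close>

lemma perp_chain_W_stable:
  assumes "s \<le> n" "q > 0"
  shows "perp_chain q n (W_mat n s :: 'k::idom mat) (m + 2) = perp_chain q n (W_mat n s) m \<longleftrightarrow> n - s \<le> m"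
proof
  assume "n - s \<le> m"
  then have "chain_index n s (m + 2) j = chain_index n s m j" for j
    by (cases "j < s") (simp_all add: chain_index_def min_absorb2)
  then show "perp_chain q n (W_mat n s :: 'k mat) (m + 2) = perp_chain q n (W_mat n s) m"
    unfolding perp_chain_W[OF assms] by simp
next
  assume eq: "perp_chain q n (W_mat n s :: 'k mat) (m + 2) = perp_chain q n (W_mat n s) m"
  show "n - s \<le> m"
  proof (rule ccontr)
    assume "\<not> n - s \<le> m"
    define j where "j = n - Suc m"
    have j: "s \<le> j" "j \<le> n" "n - j = Suc m" using \<open>\<not> n - s \<le> m\<close> by (auto simp: j_def)
    have *: "(unit_fun j :: nat \<Rightarrow> 'k) \<in> perp_chain q n (W_mat n s) k \<longleftrightarrow> chain_index n s k j" for k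
      using j(2) unfolding perp_chain_W[OF assms] by (auto simp: coord_space_def unit_fun_def)
    have "chain_index n s (m + 2) j = chain_index n s m j" using *[of "m + 2"] *[of m] eq by simp
    then show False using j by (simp add: chain_index_def)
  qed
qed

lemma normal_form_unique:
  fixes q n s s' :: nat
  assumes p: "prime CHAR('k::alg_closed_field)" "q = CHAR('k) ^ e" "q > 1" and n: "n \<ge> 1"
    and s: "s \<le> n" "s' \<le> n"
    and iso: "proj_isomorphic n (X_hyp q n (W_mat n s :: 'k mat)) (X_hyp q n (W_mat n s'))"
  shows "s = s'"
proof -
  let ?W = "W_mat n s :: 'k mat" and ?W' = "W_mat n s' :: 'k mat"
  obtain T c where T: "T \<in> carrier_mat (n + 1) (n + 1)" "invertible_mat T"
    and Tc: "\<And>k l. k \<le> n \<Longrightarrow> l \<le> n \<Longrightarrow> pullback_mat q n T ?W $$ (k, l) = c * ?W' $$ (k, l)"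
    using proj_isomorphic_X_hypD[OF p iso] by blast
  obtain S where S: "S \<in> carrier_mat (n + 1) (n + 1)"
    and ST: "S * T = 1\<^sub>m (n + 1)" "T * S = 1\<^sub>m (n + 1)"
    using invertible_mat_inverse[OF T] .
  let ?\<tau> = "lin_map n T" and ?V = "coord_space n :: (nat \<Rightarrow> 'k) set"
  have left: "lin_map n S (?\<tau> x) = x" if "x \<in> ?V" for x
    using lin_map_one[OF that] by (simp only: lin_map_mult[OF S T(1)] ST(1))
  have right: "?\<tau> (lin_map n S x) = x" if "x \<in> ?V" for x
    using lin_map_one[OF that] by (simp only: lin_map_mult[OF T(1) S] ST(2))
  have form: "mat_form q n ?W (?\<tau> x) (?\<tau> y) = c * mat_form q n ?W' x y" for x y
  proof -
    have "mat_form q n (pullback_mat q n T ?W) x y = c * mat_form q n ?W' x y"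
      unfolding mat_form_def by (simp add: Tc sum_distrib_left mult.assoc)
    then show ?thesis by (simp only: mat_form_lin_map[OF p])
  qed
  have "c \<noteq> 0"
  proof
    assume "c = 0"
    then have zero: "mat_form q n ?W x y = 0" if "x \<in> ?V" "y \<in> ?V" for x y
      using form[of "lin_map n S x" "lin_map n S y"] right that by simp
    \<comment> \<open>As \<open>n \<ge> 1\<close>, the first column of \<open>W_s\<close> has an entry 1: on the diagonal if \<open>s > 0\<close>, and just below
      it otherwise.\<close>
    define i where "i = (if s = 0 then 1 else 0 :: nat)"
    have "mat_form q n ?W (unit_fun i) (unit_fun 0) = 1"
      using n s(1) p(3) by (subst mat_form_W_unit) (auto simp: i_def unit_fun_def)
    moreover have "unit_fun i \<in> ?V" "unit_fun 0 \<in> ?V"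
      using n by (auto simp: coord_space_def unit_fun_def i_def)
    ultimately show False using zero by simp
  qed
  have chain: "perp_chain q n ?W m = ?\<tau> ` perp_chain q n ?W' m" for m
  proof (rule perp_chain_image[OF _ _ form \<open>c \<noteq> 0\<close>])
    show "?\<tau> x \<in> ?V" for x by (rule lin_map_coord_space)
    show "\<exists>x\<in>?V. ?\<tau> x = y" if "y \<in> ?V" for y using right[OF that] lin_map_coord_space by blast
  qed
  have "inj_on ?\<tau> ?V" using left by (metis inj_onI)
  then have "perp_chain q n ?W (m + 2) = perp_chain q n ?W m
      \<longleftrightarrow> perp_chain q n ?W' (m + 2) = perp_chain q n ?W' m" for m
    unfolding chain by (rule inj_on_image_eq_iff[OF _ perp_chain_subset perp_chain_subset])
  then have "n - s \<le> m \<longleftrightarrow> n - s' \<le> m" for m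
    using perp_chain_W_stable[OF s(1), of q m, where 'k = 'k] perp_chain_W_stable[OF s(2), of q m, where 'k = 'k] p(3)
    by simp
  then have "n - s = n - s'" by (metis le_antisym order_refl)
  then show "s = s'" using s by simp
qed

theorem theorem1p2:
  fixes A :: "'k::alg_closed_field mat" and p e q n :: nat
  assumes "prime p" and "CHAR('k) = p"
    and "e \<ge> 1" and "q = p ^ e"
    and "n \<ge> 1"
    and "A \<in> carrier_mat (n + 1) (n + 1)"
    and "A \<noteq> 0\<^sub>m (n + 1) (n + 1)"
    and "vec_space.rank (n + 1) A = n"
  shows "(\<exists>s\<le>n. proj_isomorphic n (X_hyp q n A) (X_hyp q n (W_mat n s))) \<and>
         (\<forall>s\<le>n. \<forall>s'\<le>n. s \<noteq> s' \<longrightarrow>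
            \<not> proj_isomorphic n (X_hyp q n (W_mat n s :: 'k mat)) (X_hyp q n (W_mat n s')))"
proof -
  have p: "prime CHAR('k)" "q = CHAR('k) ^ e" using assms by auto
  have "q > 1" using assms(1,3,4) prime_gt_1_nat[of p] one_less_power[of p e] by simp
  then show ?thesis
    using normal_form_exists[OF p _ assms(6,8)] normal_form_unique[OF p _ assms(5)] by blast
qed

end
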